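(* Let $G$ be a planar graph with maximum degree $\Delta$ and girth $g(G)$. Then $\chi'_{ss}(G)\le 2\Delta+4$ if $g(G)=7$, and $\chi'_{ss}(G)\le 2\Delta+2$ if $g(G)\ge 8$.
   Context: Graphs are finite, undirected and simple. The girth $g(G)$ is the length of a shortest cycle of $G$ (with the usual convention $g(G)=\infty$ if $G$ has no cycle). A matching $M$ of $G$ is a set of pairwise disjoint edges; $G_M$ denotes the subgraph of $G$ induced by the vertices covered by $M$. An edge is pendant in a graph if at least one of its endvertices has degree $1$ in that graph. A matching $M$ of $G$ is semistrong if every edge of $M$ is pendant in $G_M$. A semistrong edge coloring of $G$ is an assignment of colors to the edges of $G$ such that every color class is a semistrong matching of $G$. The semistrong chromatic index $\chi'_{ss}(G)$ is the minimum number of colors in a semistrong edge coloring of $G$. *)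

theory Defs
  imports "HOL-Analysis.Analysis" "HOL-Library.Extended_Nat"
begin

definition simple_graph :: "'a set \<Rightarrow> 'a set set \<Rightarrow> bool" where
  "simple_graph V E \<longleftrightarrow> finite V \<and> (\<forall>e\<in>E. e \<subseteq> V \<and> card e = 2)"

definition vdegree :: "'a set set \<Rightarrow> 'a \<Rightarrow> nat" where
  "vdegree E v = card {e \<in> E. v \<in> e}"

text \<open>Inserting 0 only matters for the graph without vertices.\<close>

definition max_degree :: "'a set \<Rightarrow> 'a set set \<Rightarrow> nat" where
  "max_degree V E = Max (insert 0 (vdegree E ` V))"

text \<open>A cycle is given by the list of its vertices in cyclic order.\<close>

definition graph_cycle :: "'a set set \<Rightarrow> 'a list \<Rightarrow> bool" where
  "graph_cycle E c \<longleftrightarrow> 3 \<le> length c \<and> distinct c \<and>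
     (\<forall>i<length c. {c ! i, c ! (Suc i mod length c)} \<in> E)"

text \<open>The infimum of the empty set in \<^typ>\<open>enat\<close> is \<open>\<infinity>\<close>, the girth of an acyclic graph.\<close>

definition girth :: "'a set set \<Rightarrow> enat" where
  "girth E = Inf {enat (length c) | c. graph_cycle E c}"

text \<open>
  A plane drawing sends the vertices to distinct points and each edge to an arc between the
  points of its two ends; the interior of an edge contains no vertex and no point of
  another edge.
\<close>

definition plane_drawing ::
    "'a set \<Rightarrow> 'a set set \<Rightarrow> ('a \<Rightarrow> complex) \<Rightarrow> ('a set \<Rightarrow> real \<Rightarrow> complex) \<Rightarrow> bool" where
  "plane_drawing V E p \<gamma> \<longleftrightarrow>
     inj_on p V \<and>
     (\<forall>e\<in>E. arc (\<gamma> e) \<and> {pathstart (\<gamma> e), pathfinish (\<gamma> e)} = p ` e \<and>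
        (path_image (\<gamma> e) - p ` e) \<inter> p ` V = {} \<and>
        (\<forall>f\<in>E. f \<noteq> e \<longrightarrow> (path_image (\<gamma> e) - p ` e) \<inter> path_image (\<gamma> f) = {}))"

definition planar :: "'a set \<Rightarrow> 'a set set \<Rightarrow> bool" where
  "planar V E \<longleftrightarrow> (\<exists>p \<gamma>. plane_drawing V E p \<gamma>)"

definition graph_matching :: "'a set set \<Rightarrow> 'a set set \<Rightarrow> bool" where
  "graph_matching E M \<longleftrightarrow> M \<subseteq> E \<and> pairwise disjnt M"

definition induced_edges :: "'a set set \<Rightarrow> 'a set \<Rightarrow> 'a set set" where
  "induced_edges E U = {e \<in> E. e \<subseteq> U}"

definition pendant :: "'a set set \<Rightarrow> 'a set \<Rightarrow> bool" where
  "pendant E e \<longleftrightarrow> e \<in> E \<and> (\<exists>v\<in>e. vdegree E v = 1)"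

definition semistrong_matching :: "'a set set \<Rightarrow> 'a set set \<Rightarrow> bool" where
  "semistrong_matching E M \<longleftrightarrow>
     graph_matching E M \<and> (\<forall>e\<in>M. pendant (induced_edges E (\<Union>M)) e)"

definition semistrong_edge_coloring :: "'a set set \<Rightarrow> nat \<Rightarrow> ('a set \<Rightarrow> nat) \<Rightarrow> bool" where
  "semistrong_edge_coloring E k c \<longleftrightarrow>
     c ` E \<subseteq> {..<k} \<and> (\<forall>i<k. semistrong_matching E {e \<in> E. c e = i})"

definition semistrong_chromatic_index :: "'a set set \<Rightarrow> nat" where
  "semistrong_chromatic_index E = (LEAST k. \<exists>c. semistrong_edge_coloring E k c)"

text \<open>The minimum above is attained: give all edges different colors.\<close>

lemma semistrong_edge_coloring_exists:
  assumes "simple_graph V E"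
  shows "\<exists>k c. semistrong_edge_coloring E k c"
proof -
  have sub: "E \<subseteq> Pow V" and fV: "finite V" and c2: "\<And>e. e \<in> E \<Longrightarrow> card e = 2"
    using assms by (auto simp: simple_graph_def)
  have fE: "finite E"
    using sub fV by (meson finite_Pow_iff finite_subset)
  obtain c where bij: "bij_betw c E {0..<card E}"
    using ex_bij_betw_finite_nat[OF fE] by (rule exE)
  have "semistrong_matching E {e \<in> E. c e = i}" if "i < card E" for i
  proof -
    have "i \<in> c ` E"
      unfolding bij_betw_imp_surj_on[OF bij] using that by simp
    then obtain e where e: "e \<in> E" "c e = i"
      by (elim imageE) simp
    have M: "{e \<in> E. c e = i} = {e}"
    proof (intro equalityI subsetI)
      fix x assume "x \<in> {e \<in> E. c e = i}"
      then have "x = e"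
        using inj_onD[OF bij_betw_imp_inj_on[OF bij], of x e] e by simp
      then show "x \<in> {e}" by simp
    qed (use e in simp)
    have ind: "induced_edges E e = {e}"
    proof
      show "induced_edges E e \<subseteq> {e}"
      proof
        fix x assume "x \<in> induced_edges E e"
        then have x: "x \<in> E" "x \<subseteq> e" by (auto simp: induced_edges_def)
        have "finite e" using c2[OF e(1)] by (simp add: card_ge_0_finite)
        then have "x = e" using x c2[OF x(1)] c2[OF e(1)] by (simp add: card_subset_eq)
        then show "x \<in> {e}" by simp
      qed
    qed (use e in \<open>auto simp: induced_edges_def\<close>)
    have "e \<noteq> {}" using c2[OF e(1)] by (metis card.empty zero_neq_numeral)
    then obtain v where v: "v \<in> e" by blast
    then have "{x \<in> {e}. v \<in> x} = {e}" by blast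
    then have "vdegree (induced_edges E e) v = 1"
      unfolding ind vdegree_def by simp
    moreover have "e \<in> induced_edges E e"
      unfolding ind by simp
    ultimately have "pendant (induced_edges E e) e"
      using v unfolding pendant_def by blast
    then show ?thesis
      unfolding M using e by (simp add: semistrong_matching_def graph_matching_def)
  qed
  moreover have "c ` E \<subseteq> {..<card E}"
    using bij_betw_imp_surj_on[OF bij] by (simp add: lessThan_atLeast0)
  ultimately show ?thesis
    unfolding semistrong_edge_coloring_def by blast
qed

end

theory Submission
  imports Defs
begin

text \<open>
  Planarity and girth enter mainly through sparsity: in a planar graph all of whose cycles have length
  at least \<open>g\<close>, every nonempty set \<open>W\<close> of vertices spans fewer than \<open>g / (g - 2) * card W\<close> edges
  (lemma \<open>planar_girth_sparse\<close>). So average degrees are below \<open>14 / 5\<close> for girth \<open>7\<close> and below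
  \<open>8 / 3\<close> for girth at least \<open>8\<close>, in all induced subgraphs. Everything else is a coloring argument for
  such sparse graphs, which for girth \<open>8\<close> also uses that there are no cycles of length four.

  The sparsity follows from Euler's formula, of which one inequality is enough. Faces are the
  components of the complement of the drawn edges. A forest has a single face by Janiszewski's
  theorem, and an edge on a cycle separates two faces by the Jordan curve theorem; this gives
  \<open>euler_inequality\<close>. Conversely, unless the graph is a forest, the edges that border a face contain a cycle
  (\<open>face_borders_cycle\<close>), hence there are at least \<open>g\<close> of them on cycles, and an edge on a cycle
  borders at most two faces, once more by Janiszewski's theorem.

  For the coloring, every edge is given a tail, the end at which it is to be pendant in the graph
  induced by its color class. Then a coloring is semistrong as soon as the color of an edge does not
  appear on any other edge that touches a neighbor of its tail. If every vertex is the tail of at most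
  two edges, then an edge from its tail \<open>u\<close> to \<open>v\<close> conflicts with about two edges for each
  neighbor of \<open>v\<close>, and otherwise only with edges at further neighbors of \<open>u\<close>
  (\<open>card_conflicts_le\<close>). So the factor \<open>2\<close> in the bounds comes from the surroundings of the head, and
  the colors suffice if the tail has few or small other neighbors.

  A discharging argument (\<open>discharge\<close>) shows that a sparse graph contains vertices for which this is
  the case: a vertex of degree at most one, or, for average degree below \<open>14 / 5\<close>, a vertex of degree
  two next to a vertex of degree at most three, or a vertex of degree four with all neighbors of
  degree two; for average degree below \<open>8 / 3\<close>, two adjacent vertices of degree two, or a vertex of
  degree three with two neighbors of degree two. In each case a few vertices are deleted, the rest is
  colored by induction, and the coloring is extended. New edges get their tails among the deleted
  vertices, so that conflicts between old edges do not change. In the last case a greedy extension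
  may lack one color. It is replaced by a list coloring argument, which works because for girth
  \<open>8\<close> the choice of tails is kept a little more economical (the parameter \<open>s\<close> of \<open>valid_tails\<close>).
\<close>

section \<open>Paths and cycles in finite graphs\<close>

definition graph_path :: "'a set set \<Rightarrow> 'a list \<Rightarrow> bool" where
  "graph_path E xs \<longleftrightarrow> distinct xs \<and> (\<forall>i. Suc i < length xs \<longrightarrow> {xs ! i, xs ! Suc i} \<in> E)"

lemma edge_endpoints:
  assumes "card e = 2" "v \<in> e"
  obtains w where "e = {v, w}" "w \<noteq> v"
  using assms by (metis card_2_iff doubleton_eq_iff insertE singletonD)

lemma graph_path_Cons:
  assumes "graph_path E xs" "xs \<noteq> []" "y \<notin> set xs" "{y, hd xs} \<in> E"
  shows "graph_path E (y # xs)"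
  unfolding graph_path_def
proof (intro conjI allI impI)
  fix i assume "Suc i < length (y # xs)"
  then show "{(y # xs) ! i, (y # xs) ! Suc i} \<in> E"
    using assms by (cases i) (auto simp: graph_path_def hd_conv_nth)
qed (use assms in \<open>auto simp: graph_path_def\<close>)

lemma graph_path_close:
  assumes "graph_path E xs" "2 \<le> j" "j < length xs" "{xs ! j, xs ! 0} \<in> E"
  shows "graph_cycle E (take (Suc j) xs)"
  unfolding graph_cycle_def
proof (intro conjI allI impI)
  let ?c = "take (Suc j) xs"
  have len: "length ?c = Suc j" using assms by simp
  show "3 \<le> length ?c" "distinct ?c" using assms len by (auto simp: graph_path_def)
  fix i assume i: "i < length ?c"
  show "{?c ! i, ?c ! (Suc i mod length ?c)} \<in> E"
  proof (cases "i = j")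
    case True
    then show ?thesis using assms len by simp
  next
    case False
    then have "i < j" using i len by simp
    then show ?thesis using assms len by (auto simp: graph_path_def)
  qed
qed

text \<open>The first vertex of a longest path is a leaf: another edge at it leads off the path, which
  makes the path longer, or back to the path, which closes a cycle.\<close>

lemma acyclic_has_leaf:
  assumes fin: "finite A" and two: "\<forall>e\<in>A. card e = 2" and ne: "A \<noteq> {}"
    and acyc: "\<nexists>c. graph_cycle A c"
  obtains e v where "e \<in> A" "v \<in> e" "\<forall>f\<in>A. v \<in> f \<longrightarrow> f = e"
proof -
  have finU: "finite (\<Union>A)"
    using fin two by (metis card_ge_0_finite finite_Union zero_less_numeral)
  have verts: "set xs \<subseteq> \<Union>A" if pa: "graph_path A xs" "2 \<le> length xs" for xs
  proof
    fix x assume "x \<in> set xs"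
    then obtain i where i: "i < length xs" "x = xs ! i" by (metis in_set_conv_nth)
    show "x \<in> \<Union>A"
    proof (cases "Suc i < length xs")
      case True
      then show ?thesis using that i by (auto simp: graph_path_def)
    next
      case False
      then obtain k where "i = Suc k" using i pa by (cases i) auto
      then show ?thesis using pa i by (auto simp: graph_path_def)
    qed
  qed
  \<comment> \<open>Paths with at least one edge, so that all their vertices are ends of edges.\<close>
  define P where "P = (\<lambda>xs. graph_path A xs \<and> 2 \<le> length xs)"
  have bound: "length xs < Suc (card (\<Union>A))" if "P xs" for xs
  proof -
    have "length xs = card (set xs)"
      using that by (simp add: P_def graph_path_def distinct_card)
    also have "\<dots> \<le> card (\<Union>A)"
      using verts that finU by (simp add: P_def card_mono)
    finally show ?thesis by simp
  qed
  obtain e0 where "e0 \<in> A" using ne by blast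
  then obtain a b where "{a, b} \<in> A" "a \<noteq> b" using two by (metis card_2_iff)
  then have "P [a, b]"
    by (auto simp: P_def graph_path_def)
  then obtain xs where xs: "P xs" and maxi: "\<And>ys. P ys \<Longrightarrow> length ys \<le> length xs"
    using ex_has_greatest_nat[of P "[a, b]" length "Suc (card (\<Union>A))"] bound by blast
  have path: "graph_path A xs" and len: "2 \<le> length xs" using xs by (auto simp: P_def)
  define x where "x = xs ! 0"
  have ne_xs: "xs \<noteq> []" using len by auto
  then have x: "x = hd xs" "xs \<noteq> []" by (auto simp: x_def hd_conv_nth)
  have e: "{x, xs ! 1} \<in> A" using path len by (auto simp: graph_path_def x_def)
  moreover have "\<forall>f\<in>A. x \<in> f \<longrightarrow> f = {x, xs ! 1}"
  proof (intro ballI impI)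
    fix f assume f: "f \<in> A" "x \<in> f"
    obtain y where y: "f = {x, y}" "y \<noteq> x"
      using edge_endpoints[of f x] two f by blast
    have "y \<in> set xs"
    proof (rule ccontr)
      assume "y \<notin> set xs"
      then have "graph_path A (y # xs)"
        using graph_path_Cons[OF path x(2)] y f x(1) by (simp add: insert_commute)
      then show False using maxi[of "y # xs"] len by (simp add: P_def)
    qed
    then obtain j where j: "j < length xs" "y = xs ! j" by (metis in_set_conv_nth)
    have "\<not> 2 \<le> j"
    proof
      assume "2 \<le> j"
      then have "graph_cycle A (take (Suc j) xs)"
        using graph_path_close[OF path] j f y by (simp add: x_def insert_commute)
      then show False using acyc by blast
    qed
    moreover have "j \<noteq> 0" using y j unfolding x_def by metis
    ultimately have "j = 1" by linarith
    then show "f = {x, xs ! 1}" using y j by simp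
  qed
  ultimately show thesis using that[of "{x, xs ! 1}" x] by blast
qed

lemma acyclic_card_edges:
  assumes "finite V" "V \<noteq> {}" "\<Union>A \<subseteq> V" "\<forall>e\<in>A. card e = 2" "\<nexists>c. graph_cycle A c"
  shows "card A < card V"
  using assms
proof (induction "card V" arbitrary: V A rule: less_induct)
  case less
  have finA: "finite A"
    using less.prems by (meson PowI Sup_upper finite_Pow_iff finite_subset order_trans subsetI)
  show ?case
  proof (cases "A = {}")
    case True
    then show ?thesis using less.prems by (simp add: card_gt_0_iff)
  next
    case False
    obtain e v where e: "e \<in> A" "v \<in> e" "\<forall>f\<in>A. v \<in> f \<longrightarrow> f = e"
      using acyclic_has_leaf[OF finA less.prems(4) False less.prems(5)] by blast
    obtain w where w: "e = {v, w}" "w \<noteq> v"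
      using edge_endpoints[of e v] e less.prems(4) by blast
    have vw: "v \<in> V" "w \<in> V - {v}" using e w less.prems(3) by blast+
    have "card (A - {e}) < card (V - {v})"
    proof (rule less.hyps)
      show "card (V - {v}) < card V" using vw less.prems(1) by (meson card_Diff1_less)
      show "\<Union>(A - {e}) \<subseteq> V - {v}" using e less.prems(3) by blast
      show "\<nexists>c. graph_cycle (A - {e}) c"
        using less.prems(5) by (auto simp: graph_cycle_def)
    qed (use less.prems vw in auto)
    moreover have "card A = Suc (card (A - {e}))" using e finA by (metis card.remove)
    moreover have "card V = Suc (card (V - {v}))" using vw less.prems(1) by (metis card.remove)
    ultimately show ?thesis by simp
  qed
qed

lemma four_cycle:
  assumes "{a, x1} \<in> E" "{x1, b} \<in> E" "{b, x2} \<in> E" "{x2, a} \<in> E" "distinct [a, x1, b, x2]"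
  shows "graph_cycle E [a, x1, b, x2]"
  using assms by (auto simp: graph_cycle_def less_Suc_eq)

definition cycle_edges :: "'a list \<Rightarrow> 'a set set" where
  "cycle_edges c = (\<lambda>i. {c ! i, c ! (Suc i mod length c)}) ` {..<length c}"

lemma graph_cycle_edges: "graph_cycle E c \<Longrightarrow> cycle_edges c \<subseteq> E"
  by (auto simp: graph_cycle_def cycle_edges_def)

lemma card_cycle_edges:
  assumes "graph_cycle E c"
  shows "card (cycle_edges c) = length c"
proof -
  let ?n = "length c"
  have n: "3 \<le> ?n" and d: "distinct c" using assms by (auto simp: graph_cycle_def)
  have "inj_on (\<lambda>i. {c ! i, c ! (Suc i mod ?n)}) {..<?n}"
  proof
    fix i j assume ij: "i \<in> {..<?n}" "j \<in> {..<?n}"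
      and eq: "{c ! i, c ! (Suc i mod ?n)} = {c ! j, c ! (Suc j mod ?n)}"
    show "i = j"
    proof (rule ccontr)
      assume "i \<noteq> j"
      moreover have "Suc i mod ?n < ?n" "Suc j mod ?n < ?n"
        using n by (auto intro!: mod_less_divisor)
      ultimately have "i = Suc j mod ?n" "j = Suc i mod ?n"
        using eq ij d by (auto simp: doubleton_eq_iff nth_eq_iff_index_eq)
      moreover have "Suc k mod ?n = (if Suc k = ?n then 0 else Suc k)" if "k < ?n" for k
        using that by (simp add: mod_Suc)
      ultimately show False using ij n by (auto split: if_splits)
    qed
  qed
  then show ?thesis by (simp add: cycle_edges_def card_image)
qed

lemma cycle_edges_nonempty: "graph_cycle E c \<Longrightarrow> cycle_edges c \<noteq> {}"
  using card_cycle_edges[of E c] by (auto simp: graph_cycle_def)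

text \<open>An edge lies on a cycle when its ends are joined by a path that avoids it. The drawing of that
  path and the edge together make up a Jordan curve.\<close>

definition on_cycle :: "'a set set \<Rightarrow> 'a set \<Rightarrow> bool" where
  "on_cycle E e \<longleftrightarrow> e \<in> E \<and> (\<exists>xs. graph_path (E - {e}) xs \<and> 2 \<le> length xs \<and> e = {hd xs, last xs})"

lemma cycle_edges_on_cycle:
  assumes cyc: "graph_cycle E c" and e: "e \<in> cycle_edges c"
  shows "on_cycle E e"
proof -
  let ?n = "length c"
  have n: "3 \<le> ?n" and d: "distinct c" using cyc by (auto simp: graph_cycle_def)
  obtain i where i: "i < ?n" "e = {c ! i, c ! (Suc i mod ?n)}"
    using e by (auto simp: cycle_edges_def)
  define xs where "xs = rotate (Suc i) c"
  have len: "length xs = ?n" by (simp add: xs_def)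
  have nth: "xs ! k = c ! ((Suc i + k) mod ?n)" if "k < ?n" for k
    unfolding xs_def by (rule nth_rotate) (rule that)
  have dx: "distinct xs" using d by (simp add: xs_def)
  have hd: "hd xs = c ! (Suc i mod ?n)"
  proof -
    have "xs \<noteq> []" using n len by auto
    moreover have "0 < ?n" using n by linarith
    ultimately show ?thesis using nth[of 0] by (simp add: hd_conv_nth)
  qed
  have xs0: "hd xs = xs ! 0" using n len by (subst hd_conv_nth) auto
  have xsl: "last xs = xs ! (?n - 1)" using n len by (subst last_conv_nth) auto
  have last: "last xs = c ! i"
  proof -
    have "Suc i + (?n - 1) = i + ?n" using n by linarith
    then have "(Suc i + (?n - 1)) mod ?n = i" using i by simp
    then show ?thesis using nth[of "?n - 1"] n xsl by simp
  qed
  have ee: "e = {hd xs, last xs}" using i hd last by auto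
  have "graph_path (E - {e}) xs"
    unfolding graph_path_def
  proof (intro conjI allI impI)
    fix k assume k: "Suc k < length xs"
    let ?m = "(Suc i + k) mod ?n"
    have m: "?m < ?n" by (rule mod_less_divisor) (use n in linarith)
    have s: "xs ! k = c ! ?m" "xs ! Suc k = c ! (Suc ?m mod ?n)"
      using nth[of k] nth[of "Suc k"] k len by (auto simp: mod_Suc_eq)
    have "{xs ! k, xs ! Suc k} \<in> E"
      using cyc m s by (simp add: graph_cycle_def)
    moreover have "{xs ! k, xs ! Suc k} \<noteq> e"
    proof
      assume "{xs ! k, xs ! Suc k} = e"
      then have "(xs ! k = xs ! 0 \<and> xs ! Suc k = xs ! (?n - 1)) \<or>
          (xs ! k = xs ! (?n - 1) \<and> xs ! Suc k = xs ! 0)"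
        using ee xs0 xsl by (simp add: doubleton_eq_iff)
      moreover have "xs ! i = xs ! j \<longleftrightarrow> i = j" if "i < ?n" "j < ?n" for i j
        using nth_eq_iff_index_eq[OF dx] that len by simp
      moreover have "k < ?n" "Suc k < ?n" "0 < ?n" "?n - 1 < ?n" using k n len by linarith+
      ultimately have "(k = 0 \<and> Suc k = ?n - 1) \<or> (k = ?n - 1 \<and> Suc k = 0)"
        by blast
      then show False using n by linarith
    qed
    ultimately show "{xs ! k, xs ! Suc k} \<in> E - {e}" by simp
  qed (use dx in simp)
  moreover have "e \<in> E" using graph_cycle_edges[OF cyc] e by blast
  moreover have "2 \<le> length xs" using n len by linarith
  ultimately show ?thesis using ee unfolding on_cycle_def by blast
qed

section \<open>Euler's inequality for plane drawings\<close>

locale plane_graph =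
  fixes V :: "'a set" and E :: "'a set set"
    and p :: "'a \<Rightarrow> complex" and \<gamma> :: "'a set \<Rightarrow> real \<Rightarrow> complex"
  assumes simple: "simple_graph V E"
    and drawing: "plane_drawing V E p \<gamma>"
begin

text \<open>Only the arcs of the edges in \<open>A\<close> are drawn. Isolated vertices would not change the number of
  faces, and without them a leaf edge can be removed together with its leaf.\<close>

definition skel :: "'a set set \<Rightarrow> complex set" where
  "skel A = (\<Union>e\<in>A. path_image (\<gamma> e))"

definition edge_interior :: "'a set \<Rightarrow> complex set" where
  "edge_interior e = path_image (\<gamma> e) - p ` e"

definition faces :: "'a set set \<Rightarrow> complex set set" where
  "faces A = components (- skel A)"

text \<open>The ends of an edge are ignored here, because many other faces may touch them.\<close>

definition borders :: "'a set \<Rightarrow> complex set \<Rightarrow> bool" where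
  "borders e F \<longleftrightarrow> edge_interior e \<inter> closure F \<noteq> {}"

lemma finV: "finite V" and card_edge: "e \<in> E \<Longrightarrow> card e = 2" and edge_sub: "e \<in> E \<Longrightarrow> e \<subseteq> V"
  using simple by (auto simp: simple_graph_def)

lemma finE: "finite E"
proof -
  have "E \<subseteq> Pow V" using edge_sub by blast
  then show ?thesis using finV by (meson finite_Pow_iff finite_subset)
qed

lemma arc_edge: "e \<in> E \<Longrightarrow> arc (\<gamma> e)"
  and ends_edge: "e \<in> E \<Longrightarrow> {pathstart (\<gamma> e), pathfinish (\<gamma> e)} = p ` e"
  and interior_vertices: "e \<in> E \<Longrightarrow> edge_interior e \<inter> p ` V = {}"
  and interior_edges: "e \<in> E \<Longrightarrow> f \<in> E \<Longrightarrow> f \<noteq> e \<Longrightarrow> edge_interior e \<inter> path_image (\<gamma> f) = {}"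
  and inj_p: "inj_on p V"
  using drawing by (auto simp: plane_drawing_def edge_interior_def)

lemma interior_skel:
  assumes "e \<in> E" "A \<subseteq> E" "e \<notin> A"
  shows "edge_interior e \<inter> skel A = {}"
  using interior_edges[OF assms(1)] assms by (auto simp: skel_def)

lemma path_image_edge:
  assumes "e \<in> E"
  shows "path_image (\<gamma> e) = edge_interior e \<union> p ` e"
proof -
  have "p ` e \<subseteq> path_image (\<gamma> e)" unfolding ends_edge[OF assms, symmetric]
    using pathstart_in_path_image pathfinish_in_path_image by blast
  then show ?thesis unfolding edge_interior_def by blast
qed

lemma vertex_on_edge:
  assumes "e \<in> E" "v \<in> V" "p v \<in> path_image (\<gamma> e)"
  shows "v \<in> e"
proof -
  have "p v \<in> p ` e"
    using assms interior_vertices[of e] path_image_edge[of e] by blast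
  then show ?thesis using inj_p edge_sub[OF assms(1)] assms(2) by (meson inj_on_image_mem_iff)
qed

lemma connected_edge_interior: "e \<in> E \<Longrightarrow> connected (edge_interior e)"
  using connected_simple_path_endless[OF arc_imp_simple_path[OF arc_edge]] ends_edge
  by (simp add: edge_interior_def)

lemma edge_interior_nonempty: "e \<in> E \<Longrightarrow> edge_interior e \<noteq> {}"
  using nonempty_simple_path_endless[OF arc_imp_simple_path[OF arc_edge]] ends_edge
  by (simp add: edge_interior_def)

lemma compact_skel: "A \<subseteq> E \<Longrightarrow> compact (skel A)"
  unfolding skel_def using finE arc_edge
  by (intro compact_UN) (auto intro: finite_subset compact_arc_image)

lemma open_compl_skel: "A \<subseteq> E \<Longrightarrow> open (- skel A)"
  using compact_skel compact_imp_closed by blast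

lemma open_face: "A \<subseteq> E \<Longrightarrow> F \<in> faces A \<Longrightarrow> open F"
  unfolding faces_def using open_components open_compl_skel by blast

lemma skel_insert: "skel (insert e A) = path_image (\<gamma> e) \<union> skel A"
  by (simp add: skel_def)

text \<open>A drawing without cycles has one face. If one leaf edge after the other is removed,
  Janiszewski's theorem applies, because the arc of a leaf edge does not separate the plane and meets
  the rest of the drawing in at most one point.\<close>

lemma connected_compl_skel_acyclic:
  assumes "A \<subseteq> E" "\<nexists>c. graph_cycle A c"
  shows "connected (- skel A)"
  using assms
proof (induction "card A" arbitrary: A rule: less_induct)
  case less
  have finA: "finite A" using less.prems finE finite_subset by blast
  show ?case
  proof (cases "A = {}")
    case True
    then show ?thesis by (simp add: skel_def connected_UNIV)
  next
    case False
    obtain e v where e: "e \<in> A" "v \<in> e" "\<forall>f\<in>A. v \<in> f \<longrightarrow> f = e"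
      using acyclic_has_leaf[OF finA _ False less.prems(2)] less.prems(1) card_edge by blast
    have eE: "e \<in> E" using e less.prems by blast
    obtain w where w: "e = {v, w}" "w \<noteq> v"
      using edge_endpoints[of e v] e card_edge eE by blast
    let ?B = "A - {e}"
    have B: "?B \<subseteq> E" using less.prems by blast
    have "skel ?B \<inter> path_image (\<gamma> e) \<subseteq> {p w}"
    proof
      fix z assume z: "z \<in> skel ?B \<inter> path_image (\<gamma> e)"
      then obtain f where f: "f \<in> ?B" "z \<in> path_image (\<gamma> f)" by (auto simp: skel_def)
      have "z \<notin> edge_interior e" using interior_edges[of e f] f eE B by blast
      then have "z = p v \<or> z = p w" using z path_image_edge[OF eE] w by auto
      moreover have "z \<noteq> p v"
      proof
        assume "z = p v"
        then have "v \<in> f" using vertex_on_edge[of f v] f B edge_sub[OF eE] e by blast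
        then show False using e f by blast
      qed
      ultimately show "z \<in> {p w}" by blast
    qed
    then have "connected (skel ?B \<inter> path_image (\<gamma> e))"
      by (metis connected_empty connected_sing subset_singletonD)
    moreover have "connected (- skel ?B)"
    proof (rule less.hyps)
      show "card ?B < card A" using e finA by (meson card_Diff1_less)
      show "\<nexists>c. graph_cycle ?B c" using less.prems(2) by (auto simp: graph_cycle_def)
    qed (rule B)
    moreover have "connected (- path_image (\<gamma> e))"
      by (rule connected_arc_complement) (use arc_edge eE in auto)
    ultimately have "connected (- (skel ?B \<union> path_image (\<gamma> e)))"
      using Janiszewski_connected compact_skel[OF B] arc_edge[OF eE] closed_arc_image by blast
    moreover have "skel ?B \<union> path_image (\<gamma> e) = skel A"
      using skel_insert[of e ?B] e(1) by (simp add: insert_absorb Un_commute)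
    ultimately show ?thesis by simp
  qed
qed

lemma arc_between:
  assumes "{u, v} \<in> E" "u \<noteq> v"
  obtains g where "arc g" "pathstart g = p u" "pathfinish g = p v"
    "path_image g = path_image (\<gamma> {u, v})"
proof -
  let ?g = "\<gamma> {u, v}"
  have "{pathstart ?g, pathfinish ?g} = {p u, p v}" using ends_edge[OF assms(1)] by simp
  then consider "pathstart ?g = p u" "pathfinish ?g = p v"
    | "pathstart ?g = p v" "pathfinish ?g = p u" by (auto simp: doubleton_eq_iff)
  then show thesis
  proof cases
    case 1
    then show ?thesis using that arc_edge assms by blast
  next
    case 2
    then show ?thesis using that[of "reversepath ?g"] arc_edge assms by (simp add: arc_reversepath)
  qed
qed

lemma arc_of_graph_path:
  assumes "graph_path A xs" "2 \<le> length xs" "A \<subseteq> E"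
  shows "\<exists>g B. arc g \<and> pathstart g = p (hd xs) \<and> pathfinish g = p (last xs) \<and>
    B \<subseteq> A \<and> \<Union>B \<subseteq> set xs \<and> path_image g = skel B"
  using assms
proof (induction xs)
  case Nil
  then show ?case by simp
next
  case (Cons x xs)
  obtain y ys where xs: "xs = y # ys" using Cons.prems by (cases xs) auto
  have xy: "{x, y} \<in> A" "x \<noteq> y"
    using Cons.prems(1) unfolding graph_path_def xs by (auto dest: spec[of _ 0])
  then have xyE: "{x, y} \<in> E" using Cons.prems by blast
  obtain h where h: "arc h" "pathstart h = p x" "pathfinish h = p y"
    "path_image h = path_image (\<gamma> {x, y})"
    using arc_between[OF xyE xy(2)] by blast
  have path: "graph_path A xs"
    using Cons.prems(1) unfolding graph_path_def by auto
  show ?case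
  proof (cases "ys = []")
    case True
    have "path_image h = skel {{x, y}}" using h by (simp add: skel_def)
    then show ?thesis using h xs True xy
      by (intro exI[of _ h] exI[of _ "{{x, y}}"]) auto
  next
    case False
    then have two: "2 \<le> length xs" using xs by (cases ys) auto
    obtain g B where g: "arc g" "pathstart g = p (hd xs)" "pathfinish g = p (last xs)"
      "B \<subseteq> A" "\<Union>B \<subseteq> set xs" "path_image g = skel B"
      using Cons.IH[OF path two Cons.prems(3)] by (elim exE conjE) (rule that)
    have x: "x \<notin> set xs" using Cons.prems(1) by (simp add: graph_path_def)
    have "path_image h \<inter> path_image g \<subseteq> {pathstart g}"
    proof
      fix z assume z: "z \<in> path_image h \<inter> path_image g"
      then obtain f where f: "f \<in> B" "z \<in> path_image (\<gamma> f)" using g by (auto simp: skel_def)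
      have fE: "f \<in> E" "x \<notin> f" using f g Cons.prems(3) x by blast+
      have "z \<notin> edge_interior {x, y}" using interior_edges[OF xyE fE(1)] fE f by blast
      then have "z = p x \<or> z = p y" using z h path_image_edge[OF xyE] by auto
      moreover have "z \<noteq> p x" using vertex_on_edge[of f x] fE f edge_sub[OF xyE] by blast
      ultimately show "z \<in> {pathstart g}" using g xs by simp
    qed
    then have "arc (h +++ g)" using arc_join[OF h(1) g(1)] h g xs by simp
    moreover have "path_image (h +++ g) = skel (insert {x, y} B)"
      using h g xs by (simp add: path_image_join skel_insert)
    moreover have "pathstart (h +++ g) = p (hd (x # xs))"
      "pathfinish (h +++ g) = p (last (x # xs))"
      using h g xs by auto
    moreover have "insert {x, y} B \<subseteq> A" using g(4) xy(1) by blast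
    moreover have "\<Union>(insert {x, y} B) \<subseteq> set (x # xs)" using g(5) xs by auto
    ultimately show ?thesis by blast
  qed
qed

text \<open>The curve runs along the edge and returns along the rest of a cycle. It meets the drawing
  without the edge exactly in the arc that returns; this set is connected, as Janiszewski's theorem
  will require.\<close>

lemma jordan_curve_through_edge:
  assumes "on_cycle A e" "A \<subseteq> E"
  obtains J where "simple_path J" "pathfinish J = pathstart J" "path_image J \<subseteq> skel A"
    "path_image (\<gamma> e) \<subseteq> path_image J" "connected (path_image J \<inter> skel (A - {e}))"
proof -
  obtain xs where xs: "e \<in> A" "graph_path (A - {e}) xs" "2 \<le> length xs" "e = {hd xs, last xs}"
    using assms by (auto simp: on_cycle_def)
  have eE: "e \<in> E" using xs assms by blast
  have AE: "A - {e} \<subseteq> E" using assms by blast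
  have ne: "last xs \<noteq> hd xs" using card_edge[OF eE] xs(4) by auto
  obtain g B where g: "arc g" "pathstart g = p (hd xs)" "pathfinish g = p (last xs)"
    "B \<subseteq> A - {e}" "path_image g = skel B"
    using arc_of_graph_path[OF xs(2,3) AE] by (elim exE conjE) (rule that)
  obtain h where h: "arc h" "pathstart h = p (last xs)" "pathfinish h = p (hd xs)"
    "path_image h = path_image (\<gamma> e)"
    using arc_between[of "last xs" "hd xs"] eE xs(4) ne by (metis insert_commute)
  have ends: "p (hd xs) \<in> path_image g" "p (last xs) \<in> path_image g"
    using g pathstart_in_path_image pathfinish_in_path_image by metis+
  have sub: "path_image (\<gamma> e) \<inter> skel (A - {e}) \<subseteq> {p (hd xs), p (last xs)}"
    using interior_skel[OF eE AE] path_image_edge[OF eE] xs(4) by auto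
  have gsub: "path_image g \<subseteq> skel (A - {e})" using g by (auto simp: skel_def)
  define J where "J = g +++ h"
  have "path_image g \<inter> path_image h \<subseteq> {pathstart g, pathstart h}"
    using sub gsub g h by auto
  then have "simple_path J"
    using simple_path_join_loop[OF g(1) h(1)] g h by (simp add: J_def)
  moreover have im: "path_image J = path_image g \<union> path_image (\<gamma> e)"
    using g h by (simp add: J_def path_image_join)
  moreover have "connected (path_image J \<inter> skel (A - {e}))"
  proof -
    have "path_image J \<inter> skel (A - {e}) = path_image g"
      using sub gsub ends im by blast
    then show ?thesis using connected_arc_image[OF g(1)] by simp
  qed
  moreover have "path_image J \<subseteq> skel A" using im gsub xs by (auto simp: skel_def)
  moreover have "pathfinish J = pathstart J" using g h by (simp add: J_def)
  moreover have "path_image (\<gamma> e) \<subseteq> path_image J" using im by simp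
  ultimately show thesis using that[of J] by blast
qed

lemma face_eqI:
  assumes "F \<in> faces A" "F' \<in> faces A" "a \<in> F" "b \<in> F'" "connected_component (- skel A) a b"
  shows "F = F'"
proof -
  have "F = connected_component_set (- skel A) x" if "F \<in> faces A" "x \<in> F" for F x
  proof -
    obtain y where "F = connected_component_set (- skel A) y"
      using \<open>F \<in> faces A\<close> by (auto simp: faces_def components_def)
    then show ?thesis using \<open>x \<in> F\<close> connected_component_eq by metis
  qed
  then have "F = connected_component_set (- skel A) a" "F' = connected_component_set (- skel A) b"
    using assms by auto
  then show ?thesis using connected_component_eq[of b "- skel A" a] assms(5) by simp
qed

lemma face_of_point:
  assumes "z \<notin> skel A"
  shows "connected_component_set (- skel A) z \<in> faces A" "z \<in> connected_component_set (- skel A) z"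
  using assms by (auto simp: faces_def components_def)

lemma face_sub: "F \<in> faces A \<Longrightarrow> F \<subseteq> - skel A"
  unfolding faces_def by (rule in_components_subset)

lemma face_connected: "F \<in> faces A \<Longrightarrow> connected F"
  unfolding faces_def by (rule in_components_connected)

lemma face_nonempty: "F \<in> faces A \<Longrightarrow> F \<noteq> {}"
  unfolding faces_def by (rule in_components_nonempty)

lemma faces_nonoverlap: "F \<in> faces A \<Longrightarrow> F' \<in> faces A \<Longrightarrow> z \<in> F \<Longrightarrow> z \<in> F' \<Longrightarrow> F = F'"
  using components_nonoverlap unfolding faces_def by blast

lemma face_mono:
  assumes "F \<in> faces A" "G \<in> faces B" "B \<subseteq> A" "z \<in> F" "z \<in> G"
  shows "F \<subseteq> G"
proof -
  have "F \<subseteq> - skel B" using face_sub[OF assms(1)] assms(3) by (auto simp: skel_def)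
  then show ?thesis
    using components_maximal[of G "- skel B" F] assms face_connected[OF assms(1)]
    unfolding faces_def by blast
qed

text \<open>When \<open>e\<close> is deleted, its interior becomes part of a single face, which absorbs all faces that
  \<open>e\<close> borders.\<close>

lemma bordering_face_sub:
  assumes "e \<in> A" "A \<subseteq> E" "F \<in> faces A" "borders e F" "m \<in> edge_interior e"
  shows "F \<subseteq> connected_component_set (- skel (A - {e})) m"
proof -
  let ?U = "- skel (A - {e})"
  let ?C = "connected_component_set ?U m"
  have AE: "A - {e} \<subseteq> E" "e \<in> E" using assms by blast+
  have "edge_interior e \<subseteq> ?U" using interior_skel[of e "A - {e}"] AE by blast
  then have I: "edge_interior e \<subseteq> ?C"
    using connected_component_maximal[OF assms(5) connected_edge_interior[OF AE(2)]] by simp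
  have C: "?C \<in> faces (A - {e})"
    using face_of_point(1) interior_skel[of e "A - {e}"] AE assms(5) by blast
  obtain z where "z \<in> edge_interior e" "z \<in> closure F" using assms(4) by (auto simp: borders_def)
  then have "?C \<inter> closure F \<noteq> {}" using I by blast
  moreover have "open ?C" using open_face[OF AE(1) C] .
  ultimately obtain x where "x \<in> ?C" "x \<in> F" using open_Int_closure_eq_empty by blast
  then show ?thesis using face_mono[OF assms(3) C] by blast
qed

text \<open>On each side of a Jordan curve through \<open>e\<close> there is only one face bordered by \<open>e\<close>. Two
  points in such faces are separated neither by the curve (same side) nor by the drawing without \<open>e\<close>
  (both faces merge when \<open>e\<close> is deleted). The curve and this drawing meet in a connected set, so by
  Janiszewski's theorem their union, which is the whole drawing, does not separate the points.\<close>

lemma bordering_faces_eq: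
  assumes A: "A \<subseteq> E" "e \<in> A" and F: "F \<in> faces A" "borders e F" "F' \<in> faces A" "borders e F'"
    and J: "simple_path J" "path_image J \<subseteq> skel A"
    "path_image (\<gamma> e) \<subseteq> path_image J" "connected (path_image J \<inter> skel (A - {e}))"
    and ab: "a \<in> F" "b \<in> F'" "connected_component (- path_image J) a b"
  shows "F = F'"
proof -
  obtain m where m: "m \<in> edge_interior e" using edge_interior_nonempty A by blast
  let ?S = "skel (A - {e})"
  have AE: "A - {e} \<subseteq> E" using A by blast
  have "connected_component (- ?S) m a" "connected_component (- ?S) m b"
    using bordering_face_sub[OF A(2,1) _ _ m] F ab by blast+
  then have "connected_component (- ?S) a b"
    by (metis connected_component_sym connected_component_trans)
  moreover have "connected (?S \<inter> path_image J)" using J(4) by (simp add: Int_commute)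
  moreover have "closed (path_image J)" using J(1) by (rule closed_simple_path_image)
  ultimately have "connected_component (- (?S \<union> path_image J)) a b"
    using Janiszewski compact_skel[OF AE] ab(3) by blast
  moreover have "?S \<union> path_image J = skel A"
    using J(2,3) skel_insert[of e "A - {e}"] A(2) by (auto simp: insert_absorb)
  ultimately have "connected_component (- skel A) a b" by simp
  then show ?thesis using face_eqI F(1,3) ab(1,2) by blast
qed

text \<open>A Jordan curve through the edge has only two sides.\<close>

lemma at_most_two_bordering_faces:
  assumes "on_cycle A e" "A \<subseteq> E"
  shows "finite {F \<in> faces A. borders e F}" "card {F \<in> faces A. borders e F} \<le> 2"
proof -
  obtain J where J: "simple_path J" "pathfinish J = pathstart J" "path_image J \<subseteq> skel A"
    "path_image (\<gamma> e) \<subseteq> path_image J" "connected (path_image J \<inter> skel (A - {e}))"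
    using jordan_curve_through_edge[OF assms] by blast
  have eA: "e \<in> A" using assms by (simp add: on_cycle_def)
  let ?I = "inside (path_image J)" and ?O = "outside (path_image J)"
  have IO: "connected ?I" "connected ?O" "?I \<union> ?O = - path_image J"
    using Jordan_inside_outside[OF J(1,2)] by auto
  let ?X = "{F \<in> faces A. borders e F}"
  have inj: "inj_on (\<lambda>F. F \<inter> ?I \<noteq> {}) ?X"
  proof
    fix F F' assume F: "F \<in> ?X" "F' \<in> ?X" and eq: "(F \<inter> ?I \<noteq> {}) = (F' \<inter> ?I \<noteq> {})"
    have off: "G \<subseteq> ?I \<union> ?O" "G \<noteq> {}" if "G \<in> ?X" for G
      using face_sub[of G A] face_nonempty[of G A] that J(3) IO(3) by blast+
    have "\<exists>a\<in>F. \<exists>b\<in>F'. connected_component (- path_image J) a b"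
    proof (cases "F \<inter> ?I \<noteq> {}")
      case True
      then obtain a b where "a \<in> F" "b \<in> F'" "a \<in> ?I" "b \<in> ?I" using eq by blast
      moreover have "?I \<subseteq> - path_image J" using IO(3) by blast
      ultimately show ?thesis using IO(1) unfolding connected_component_def by blast
    next
      case False
      then obtain a b where "a \<in> F" "b \<in> F'" "a \<in> ?O" "b \<in> ?O"
        using eq off[OF F(1)] off[OF F(2)] by blast
      moreover have "?O \<subseteq> - path_image J" using IO(3) by blast
      ultimately show ?thesis using IO(2) unfolding connected_component_def by blast
    qed
    then show "F = F'"
      using bordering_faces_eq[OF assms(2) eA _ _ _ _ J(1,3,4,5)] F by blast
  qed
  show "finite ?X" by (rule finite_imageD[OF _ inj]) simp
  have "card ?X = card ((\<lambda>F. F \<inter> ?I \<noteq> {}) ` ?X)" using card_image[OF inj] by simp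
  also have "\<dots> \<le> card (UNIV :: bool set)" by (rule card_mono) auto
  finally show "card ?X \<le> 2" by simp
qed

text \<open>Each point of a Jordan curve through \<open>e\<close> is in the closure of its inside and of its outside. So
  the face that contains the interior of \<open>e\<close> after the deletion of \<open>e\<close> contains two different old faces,
  while every other new face contains at least one.\<close>

lemma card_faces_delete_cycle_edge:
  assumes cyc: "on_cycle A e" and A: "A \<subseteq> E" and fin: "finite (faces A)"
  shows "card (faces (A - {e})) < card (faces A)"
proof -
  obtain J where J: "simple_path J" "pathfinish J = pathstart J" "path_image J \<subseteq> skel A"
    "path_image (\<gamma> e) \<subseteq> path_image J" "connected (path_image J \<inter> skel (A - {e}))"
    using jordan_curve_through_edge[OF cyc A] by blast
  let ?I = "inside (path_image J)" and ?O = "outside (path_image J)"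
  have IO: "open ?I" "open ?O" "?I \<inter> ?O = {}" "?I \<union> ?O = - path_image J"
    "frontier ?I = path_image J" "frontier ?O = path_image J"
    using Jordan_inside_outside[OF J(1,2)] by auto
  let ?B = "A - {e}"
  have eA: "e \<in> A" using cyc by (simp add: on_cycle_def)
  have B: "?B \<subseteq> E" "?B \<subseteq> A" and eE: "e \<in> E" using A eA by blast+
  have skA: "skel A = path_image (\<gamma> e) \<union> skel ?B"
    using skel_insert[of e ?B] eA by (simp add: insert_absorb)
  have smaller: "\<exists>F\<in>faces A. F \<subseteq> G" if G: "G \<in> faces ?B" for G
  proof -
    have "\<exists>z\<in>G. z \<notin> path_image J"
    proof (rule ccontr)
      assume "\<not> ?thesis"
      then have sub: "G \<subseteq> frontier ?I" using IO(5) by blast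
      then have "G \<inter> closure ?I \<noteq> {}" using face_nonempty[OF G] by (auto simp: frontier_def)
      then have "G \<inter> ?I \<noteq> {}" using open_Int_closure_eq_empty[OF open_face[OF B(1) G]] by blast
      then show False using sub IO(4,5) by blast
    qed
    then obtain z where z: "z \<in> G" "z \<notin> path_image J" by blast
    then have "z \<notin> skel A" using face_sub[OF G] skA J(4) by blast
    then show ?thesis using face_mono[OF face_of_point(1) G B(2) face_of_point(2)] face_of_point(1) z
      by blast
  qed
  then obtain \<psi> where \<psi>: "\<And>G. G \<in> faces ?B \<Longrightarrow> \<psi> G \<in> faces A \<and> \<psi> G \<subseteq> G" by metis
  have below: "G = G'" if "G \<in> faces ?B" "G' \<in> faces ?B" "\<psi> G \<subseteq> G'" for G G'
    using \<psi>[OF that(1)] that face_nonempty faces_nonoverlap by (metis subset_empty subset_iff ex_in_conv)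
  then have inj: "inj_on \<psi> (faces ?B)" using \<psi> by (metis inj_onI)
  obtain m where m: "m \<in> edge_interior e" using edge_interior_nonempty eE by blast
  let ?C = "connected_component_set (- skel ?B) m"
  have "m \<notin> skel ?B" using interior_skel[of e ?B] m B eE by blast
  then have C: "?C \<in> faces ?B" "m \<in> ?C" using face_of_point by blast+
  have mJ: "m \<in> path_image J" using m J(4) by (auto simp: edge_interior_def)
  have "?C \<inter> closure ?I \<noteq> {}" "?C \<inter> closure ?O \<noteq> {}"
  proof -
    have "m \<in> closure ?I" "m \<in> closure ?O" using mJ IO(5,6) unfolding frontier_def by blast+
    then show "?C \<inter> closure ?I \<noteq> {}" "?C \<inter> closure ?O \<noteq> {}" using C(2) by blast+
  qed
  then have "?C \<inter> ?I \<noteq> {}" "?C \<inter> ?O \<noteq> {}"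
    unfolding open_Int_closure_eq_empty[OF open_face[OF B(1) C(1)]] by simp_all
  then obtain a b where a: "a \<in> ?C \<inter> ?I" and b: "b \<in> ?C \<inter> ?O"
    unfolding ex_in_conv[symmetric] by (elim exE) (rule that)
  then have ab: "a \<in> ?C" "a \<in> ?I" "b \<in> ?C" "b \<in> ?O" by simp_all
  have CB: "?C \<subseteq> - skel ?B" using face_sub[OF C(1)] .
  have off: "x \<notin> skel A" if "x \<in> ?C" "x \<in> ?I \<or> x \<in> ?O" for x
  proof -
    have "x \<notin> skel ?B" using that(1) CB by blast
    moreover have "x \<notin> path_image (\<gamma> e)" using that(2) J(4) IO(4) by blast
    ultimately show ?thesis using skA by simp
  qed
  have off: "a \<notin> skel A" "b \<notin> skel A" using off ab by simp_all
  let ?F = "\<lambda>x. connected_component_set (- skel A) x"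
  have Fab: "?F a \<in> faces A" "?F b \<in> faces A" "?F a \<subseteq> ?C" "?F b \<subseteq> ?C"
    using face_of_point off face_mono[OF _ C(1) B(2)] ab by blast+
  have ne: "?F a \<noteq> ?F b"
  proof
    assume eq: "?F a = ?F b"
    have "a \<in> ?F a" "b \<in> ?F a" using off eq face_of_point(2) by blast+
    moreover have "?F a \<subseteq> ?I \<union> ?O" using face_sub[OF Fab(1)] J(3) IO(4) by blast
    ultimately show False
      using connectedD[of "?F a" ?I ?O] IO(1,2,3) ab face_connected[OF Fab(1)] by blast
  qed
  have "\<psi> ` faces ?B \<subset> faces A"
  proof
    show "\<psi> ` faces ?B \<subseteq> faces A" using \<psi> by blast
    have only: "F = \<psi> ?C" if "F \<in> \<psi> ` faces ?B" "F \<subseteq> ?C" for F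
    proof -
      obtain G where G: "G \<in> faces ?B" "F = \<psi> G" using \<open>F \<in> \<psi> ` faces ?B\<close> by blast
      then have "G = ?C" using below[OF G(1) C(1)] \<open>F \<subseteq> ?C\<close> by simp
      then show ?thesis using G by simp
    qed
    show "\<psi> ` faces ?B \<noteq> faces A"
    proof
      assume eq: "\<psi> ` faces ?B = faces A"
      have "?F a = \<psi> ?C" "?F b = \<psi> ?C" by (rule only; use Fab eq in simp)+
      then show False using ne by simp
    qed
  qed
  then show ?thesis using card_image[OF inj] psubset_card_mono[OF fin] by metis
qed

text \<open>If the edges that border \<open>F\<close> contained no cycle, then the complement of these edges and of all
  vertices would be connected. It meets \<open>F\<close> but not the frontier of \<open>F\<close>, so it would lie within
  \<open>F\<close>, and then all edges would border \<open>F\<close>, including those of the given cycle.\<close>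

lemma face_borders_cycle:
  assumes A: "A \<subseteq> E" "graph_cycle A c0" and F: "F \<in> faces A"
  shows "\<exists>c. graph_cycle {e \<in> A. borders e F} c"
proof (rule ccontr)
  let ?B = "{e \<in> A. borders e F}"
  assume acyc: "\<not> ?thesis"
  have B: "?B \<subseteq> E" using A by blast
  \<comment> \<open>All vertices are removed as well, so that a frontier point of \<open>F\<close> outside \<open>T\<close> would be an
    interior point of an edge.\<close>
  define T where "T = p ` V \<union> skel ?B"
  have "connected (- skel ?B - p ` V)"
    using connected_open_delete_finite[OF open_compl_skel[OF B] connected_compl_skel_acyclic[OF B acyc]]
      finV by simp
  moreover have "- skel ?B - p ` V = - T" by (auto simp: T_def)
  ultimately have conn: "connected (- T)" by simp
  have opF: "open F" using open_face A F by blast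
  have on_edge: "\<exists>e\<in>A. z \<in> edge_interior e" if "z \<in> skel A" "z \<notin> p ` V" for z
    using that A path_image_edge edge_sub unfolding skel_def by blast
  have "- T \<subseteq> F \<union> - closure F"
  proof
    fix z assume z: "z \<in> - T"
    show "z \<in> F \<union> - closure F"
    proof (cases "z \<in> closure F")
      case True
      have zA: "z \<notin> skel A"
      proof
        assume "z \<in> skel A"
        then obtain e where e: "e \<in> A" "z \<in> edge_interior e" using on_edge z by (auto simp: T_def)
        then have "e \<in> ?B" using True by (auto simp: borders_def)
        then show False using z e by (auto simp: T_def skel_def edge_interior_def)
      qed
      let ?Z = "connected_component_set (- skel A) z"
      have Z: "?Z \<in> faces A" "z \<in> ?Z" using face_of_point zA by blast+
      then have "?Z \<inter> F \<noteq> {}" using True open_face[OF A(1) Z(1)] open_Int_closure_eq_empty by blast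
      then have "?Z = F" using faces_nonoverlap Z F by blast
      then show ?thesis using Z by blast
    qed simp
  qed
  moreover have "F \<inter> - T \<noteq> {}"
  proof -
    have "\<not> finite F" using finite_imp_not_open[of F] opF face_nonempty[OF F] by blast
    then have "\<not> F \<subseteq> p ` V" using finV finite_subset by blast
    then obtain z where "z \<in> F" "z \<notin> p ` V" by blast
    moreover have "skel ?B \<subseteq> skel A" by (auto simp: skel_def)
    ultimately show ?thesis using face_sub[OF F] unfolding T_def by blast
  qed
  ultimately have sub: "- T \<subseteq> F"
    using connectedD[OF conn opF, of "- closure F"] closure_subset[of F] by blast
  have "A \<subseteq> ?B"
  proof
    fix e assume e: "e \<in> A"
    obtain z where z: "z \<in> edge_interior e" using e A edge_interior_nonempty by blast
    then have "z \<in> skel A" using e by (auto simp: skel_def edge_interior_def)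
    then have "z \<in> T" using sub face_sub[OF F] by blast
    then have "z \<in> skel ?B" using interior_vertices[of e] e A z by (auto simp: T_def)
    then show "e \<in> ?B" using interior_skel[of e ?B] B e A z by blast
  qed
  then have "?B = A" by blast
  then show False using acyc A(2) by auto
qed

lemma finite_faces:
  assumes "A \<subseteq> E"
  shows "finite (faces A)"
proof (cases "\<exists>c. graph_cycle A c")
  case False
  then have "connected (- skel A)" using connected_compl_skel_acyclic[OF assms] by blast
  then have "faces A \<subseteq> {- skel A}" unfolding faces_def
    by (metis components_eq_sing_iff components_empty empty_subsetI order_refl)
  then show ?thesis by (rule finite_subset) simp
next
  case True
  let ?X = "\<lambda>e. {F \<in> faces A. borders e F}"
  let ?D = "{e \<in> A. on_cycle A e}"
  have "faces A \<subseteq> (\<Union>e\<in>?D. ?X e)"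
  proof
    fix F assume F: "F \<in> faces A"
    obtain c where c: "graph_cycle {e \<in> A. borders e F} c" using face_borders_cycle[OF assms _ F] True by blast
    then have cA: "graph_cycle A c" by (auto simp: graph_cycle_def)
    obtain e where e: "e \<in> cycle_edges c" using cycle_edges_nonempty[OF c] by blast
    then have "e \<in> A" "borders e F" "on_cycle A e"
      using graph_cycle_edges[OF c] cycle_edges_on_cycle[OF cA] by blast+
    then show "F \<in> (\<Union>e\<in>?D. ?X e)" using F by blast
  qed
  moreover have "finite (\<Union>e\<in>?D. ?X e)"
  proof (rule finite_UN_I)
    show "finite ?D" using assms finE by (auto intro: finite_subset)
  qed (use at_most_two_bordering_faces(1) assms in blast)
  ultimately show ?thesis by (rule finite_subset)
qed

text \<open>This is the half of Euler's formula that bounds the number of edges from above. Deleting an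
  edge of a cycle loses a face, and a forest has fewer edges than vertices.\<close>

lemma euler_inequality:
  assumes "A \<subseteq> E" "V \<noteq> {}"
  shows "card A + 2 \<le> card (faces A) + card V"
  using assms(1)
proof (induction "card A" arbitrary: A rule: less_induct)
  case less
  have finA: "finite A" using less.prems finE finite_subset by blast
  have fin: "finite (faces A)" using finite_faces less.prems by blast
  show ?case
  proof (cases "\<exists>c. graph_cycle A c")
    case False
    have "card A < card V"
    proof (rule acyclic_card_edges[OF finV assms(2)])
      show "\<Union>A \<subseteq> V" using less.prems edge_sub by blast
      show "\<forall>e\<in>A. card e = 2" using less.prems card_edge by blast
    qed (rule False)
    moreover have "faces A \<noteq> {}"
    proof
      assume "faces A = {}"
      then have "skel A = UNIV" by (auto simp: faces_def components_def)
      then show False using compact_imp_bounded[OF compact_skel[OF less.prems]] not_bounded_UNIV by metis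
    qed
    then have "0 < card (faces A)" using fin by (simp add: card_gt_0_iff)
    ultimately show ?thesis by linarith
  next
    case True
    then obtain c where c: "graph_cycle A c" by blast
    then obtain e where e: "on_cycle A e" using cycle_edges_nonempty[OF c] cycle_edges_on_cycle[OF c] by blast
    then have eA: "e \<in> A" by (simp add: on_cycle_def)
    have card: "card A = Suc (card (A - {e}))" using eA finA by (metis card.remove)
    moreover have "card (A - {e}) + 2 \<le> card (faces (A - {e})) + card V"
    proof (rule less.hyps)
      show "card (A - {e}) < card A" using card by simp
      show "A - {e} \<subseteq> E" using less.prems by blast
    qed
    ultimately show ?thesis using card_faces_delete_cycle_edge[OF e less.prems fin] by linarith
  qed
qed

text \<open>Count the pairs of a face and an edge of a cycle that borders it: there are at least \<open>g\<close> for
  each face and at most two for each edge. Bridges must be left out of the count, because the bound of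
  two bordering faces was obtained from a cycle through the edge.\<close>

lemma faces_edges_count:
  assumes girth: "\<And>c. graph_cycle E c \<Longrightarrow> g \<le> length c" and cyc: "graph_cycle E c0"
  shows "g * card (faces E) \<le> 2 * card E"
proof -
  let ?b = "\<lambda>e F. on_cycle E e \<and> borders e F"
  have fin: "finite (faces E)" using finite_faces by blast
  have ge: "g \<le> card {e \<in> E. ?b e F}" if F: "F \<in> faces E" for F
  proof -
    obtain c where c: "graph_cycle {e \<in> E. borders e F} c"
      using face_borders_cycle[OF order_refl cyc F] by blast
    then have cE: "graph_cycle E c" by (auto simp: graph_cycle_def)
    have "cycle_edges c \<subseteq> {e \<in> E. ?b e F}"
      using graph_cycle_edges[OF c] cycle_edges_on_cycle[OF cE] by blast
    then have "card (cycle_edges c) \<le> card {e \<in> E. ?b e F}" using finE by (intro card_mono) auto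
    then show ?thesis using card_cycle_edges[OF c] girth[OF cE] by simp
  qed
  have le: "card {F \<in> faces E. ?b e F} \<le> 2" for e
  proof (cases "on_cycle E e")
    case True
    then show ?thesis using at_most_two_bordering_faces(2)[OF True] by simp
  qed simp
  have "g * card (faces E) \<le> (\<Sum>F\<in>faces E. card {e \<in> E. ?b e F})"
    using sum_mono[of "faces E" "\<lambda>_. g"] ge by (simp add: mult.commute)
  also have "\<dots> = (\<Sum>F\<in>faces E. \<Sum>e\<in>E. of_bool (?b e F))"
    using finE by (intro sum.cong) (auto simp: sum_of_bool_eq Int_def)
  also have "\<dots> = (\<Sum>e\<in>E. \<Sum>F\<in>faces E. of_bool (?b e F))" by (rule sum.swap)
  also have "\<dots> = (\<Sum>e\<in>E. card {F \<in> faces E. ?b e F})"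
    using fin by (intro sum.cong) (auto simp: sum_of_bool_eq Int_def)
  also have "\<dots> \<le> (\<Sum>e\<in>E. 2)" using le by (intro sum_mono) auto
  finally show ?thesis by simp
qed

end

text \<open>Eliminating the number of faces from Euler's inequality and the count of pairs. Subgraphs inherit
  the drawing and the lower bound for the length of cycles.\<close>

lemma planar_girth_sparse:
  assumes "simple_graph V E" "planar V E" "W \<subseteq> V" "W \<noteq> {}" "2 \<le> g"
    and girth: "\<And>c. graph_cycle E c \<Longrightarrow> g \<le> length c"
  shows "(g - 2) * card (induced_edges E W) < g * card W"
proof -
  let ?A = "induced_edges E W"
  obtain p \<gamma> where d: "plane_drawing V E p \<gamma>" using assms(2) by (auto simp: planar_def)
  have AE: "?A \<subseteq> E" by (auto simp: induced_edges_def)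
  have finW: "finite W" using assms by (auto simp: simple_graph_def intro: finite_subset)
  have "simple_graph W ?A" using assms(1) finW by (auto simp: simple_graph_def induced_edges_def)
  moreover have "plane_drawing W ?A p \<gamma>"
    unfolding plane_drawing_def
  proof (intro conjI ballI impI)
    show "inj_on p W" using d assms(3) by (auto simp: plane_drawing_def intro: inj_on_subset)
    fix e assume "e \<in> ?A"
    then have e: "e \<in> E" using AE by blast
    show "arc (\<gamma> e)" "{pathstart (\<gamma> e), pathfinish (\<gamma> e)} = p ` e"
      using d e by (simp_all add: plane_drawing_def)
    have "(path_image (\<gamma> e) - p ` e) \<inter> p ` V = {}" using d e by (simp add: plane_drawing_def)
    then show "(path_image (\<gamma> e) - p ` e) \<inter> p ` W = {}" using assms(3) by blast
    fix f assume f: "f \<in> ?A" "f \<noteq> e"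
    then have "f \<in> E" using AE by blast
    then show "(path_image (\<gamma> e) - p ` e) \<inter> path_image (\<gamma> f) = {}"
      using d e f(2) by (simp add: plane_drawing_def)
  qed
  ultimately interpret plane_graph W ?A p \<gamma> by unfold_locales
  have cycA: "g \<le> length c" if "graph_cycle ?A c" for c
    using girth[of c] that AE by (auto simp: graph_cycle_def)
  have pos: "0 < card W" using finW assms(4) by (simp add: card_gt_0_iff)
  show ?thesis
  proof (cases "\<exists>c. graph_cycle ?A c")
    case False
    have "card ?A < card W"
    proof (rule acyclic_card_edges[OF finW assms(4)])
      show "\<Union>?A \<subseteq> W" using edge_sub by blast
      show "\<forall>e\<in>?A. card e = 2" using card_edge by blast
    qed (rule False)
    then have "(g - 2) * card ?A \<le> (g - 2) * card W" by simp
    also have "\<dots> < g * card W" using pos assms(5) by simp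
    finally show ?thesis .
  next
    case True
    then obtain c where "graph_cycle ?A c" by blast
    then have "g * card (faces ?A) \<le> 2 * card ?A" using faces_edges_count[OF cycA] by simp
    moreover have "g * (card ?A + 2) \<le> g * (card (faces ?A) + card W)"
      using euler_inequality[OF order_refl assms(4)] mult_le_mono2 by blast
    moreover have "0 < g" using assms(5) by simp
    ultimately have "g * card ?A < 2 * card ?A + g * card W"
      by (simp add: add_mult_distrib2)
    moreover have "0 < g * card W" using pos assms(5) by simp
    ultimately have "g * card ?A - 2 * card ?A < g * card W" by linarith
    then show ?thesis by (simp add: diff_mult_distrib)
  qed
qed

section \<open>Colorings with a prescribed pendant end\<close>

definition nbrs :: "'a set set \<Rightarrow> 'a \<Rightarrow> 'a set" where
  "nbrs E v = {w. {v, w} \<in> E}"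

definition star :: "'a set set \<Rightarrow> 'a \<Rightarrow> 'a set set" where
  "star E v = {e \<in> E. v \<in> e}"

definition outs :: "'a set set \<Rightarrow> ('a set \<Rightarrow> 'a) \<Rightarrow> 'a \<Rightarrow> 'a set set" where
  "outs E t v = {e \<in> E. t e = v}"

text \<open>An edge from \<open>v\<close> to \<open>w\<close> in this set makes the neighbor \<open>w\<close> contribute three edges to the
  conflicts near \<open>v\<close>, namely this edge and two edges with tail \<open>w\<close>; every other neighbor contributes
  at most two.\<close>

definition excess :: "'a set set \<Rightarrow> ('a set \<Rightarrow> 'a) \<Rightarrow> 'a \<Rightarrow> 'a set set" where
  "excess E t v = {e \<in> outs E t v. \<exists>w\<in>e. w \<noteq> v \<and> 2 \<le> card (outs E t w)}"

text \<open>The tail of an edge is the end that shall have degree one in the graph induced by its color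
  class. The parameter \<open>s\<close> is \<open>2\<close> or \<open>1\<close>: for \<open>2\<close> the bound on the excess follows from the bound on
  the number of edges with a given tail, while \<open>1\<close> is a stronger requirement that saves one color.\<close>

definition valid_tails :: "'a set set \<Rightarrow> ('a set \<Rightarrow> 'a) \<Rightarrow> nat \<Rightarrow> bool" where
  "valid_tails E t s \<longleftrightarrow>
     (\<forall>e\<in>E. t e \<in> e) \<and> (\<forall>v. card (outs E t v) \<le> 2 \<and> card (excess E t v) \<le> s)"

text \<open>The colors of \<open>e\<close> and \<open>f\<close> must differ if \<open>f\<close> touches a neighbor of the tail of \<open>e\<close>, or vice
  versa. This covers adjacent edges: if they share the tail of \<open>e\<close>, then the other end of \<open>f\<close> is a
  neighbor of that tail, and otherwise the common end is one.\<close>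

definition conflicts :: "'a set set \<Rightarrow> ('a set \<Rightarrow> 'a) \<Rightarrow> 'a set \<Rightarrow> 'a set set" where
  "conflicts E t e =
     {f \<in> E. f \<noteq> e \<and> (f \<inter> nbrs E (t e) \<noteq> {} \<or> e \<inter> nbrs E (t f) \<noteq> {})}"

text \<open>Only the edges in \<open>A\<close> are colored yet, but conflicts refer to the whole graph \<open>E\<close>.\<close>

definition proper_on :: "'a set set \<Rightarrow> ('a set \<Rightarrow> 'a) \<Rightarrow> 'a set set \<Rightarrow> ('a set \<Rightarrow> nat) \<Rightarrow> bool" where
  "proper_on E t A c \<longleftrightarrow> (\<forall>e\<in>A. \<forall>f\<in>A. f \<in> conflicts E t e \<longrightarrow> c e \<noteq> c f)"

definition tail_colorable :: "'a set set \<Rightarrow> nat \<Rightarrow> nat \<Rightarrow> bool" where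
  "tail_colorable E s N \<longleftrightarrow> (\<exists>t c. valid_tails E t s \<and> c ` E \<subseteq> {..<N} \<and> proper_on E t E c)"

lemma conflicts_sym: "e \<in> E \<Longrightarrow> f \<in> conflicts E t e \<Longrightarrow> e \<in> conflicts E t f"
  by (auto simp: conflicts_def)

text \<open>An edge that leads from the tail of \<open>e\<close> to another vertex covered by the color class of \<open>e\<close>
  ends at a neighbor of that tail. So the edge of the class that covers this neighbor conflicts with
  \<open>e\<close> unless it is \<open>e\<close> itself.\<close>

lemma tail_colorable_imp_semistrong:
  assumes simple: "\<forall>e\<in>E. card e = 2" and col: "tail_colorable E s N"
  shows "\<exists>c. semistrong_edge_coloring E N c"
proof -
  obtain t c where t: "\<forall>e\<in>E. t e \<in> e" and c: "c ` E \<subseteq> {..<N}" "proper_on E t E c"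
    using col by (auto simp: tail_colorable_def valid_tails_def)
  have same: "e = f" if "e \<in> E" "f \<in> E" "c e = c f" "z \<in> f" "z \<in> nbrs E (t e)" for e f z
    using c(2) that by (auto simp: proper_on_def conflicts_def)
  have "semistrong_matching E {e \<in> E. c e = i}" for i
  proof -
    let ?M = "{e \<in> E. c e = i}"
    have "e = f" if e: "e \<in> ?M" and f: "f \<in> ?M" and z: "z \<in> e" "z \<in> f" for e f z
    proof (cases "z = t e")
      case True
      have "card f = 2" using simple f by blast
      then obtain w where "f = {z, w}" using edge_endpoints[OF _ z(2)] by blast
      then show ?thesis using same[of e f w] e f True by (auto simp: nbrs_def)
    next
      case False
      have te: "card e = 2" "t e \<in> e" using t e simple by auto
      obtain w where "e = {t e, w}" using edge_endpoints[OF te] by blast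
      then have "e = {t e, z}" using False z(1) by auto
      then have "{t e, z} \<in> E" using e by simp
      then show ?thesis using same[of e f z] e f z by (auto simp: nbrs_def)
    qed
    then have "graph_matching E ?M"
      by (auto simp: graph_matching_def pairwise_def disjnt_def)
    moreover have "pendant (induced_edges E (\<Union>?M)) e" if e: "e \<in> ?M" for e
    proof -
      let ?I = "induced_edges E (\<Union>?M)"
      have eI: "e \<in> ?I" using e by (auto simp: induced_edges_def)
      have te: "t e \<in> e" using t e by blast
      have "f = e" if f: "f \<in> ?I" "t e \<in> f" for f
      proof -
        have fE: "f \<in> E" "f \<subseteq> \<Union>?M" using f by (auto simp: induced_edges_def)
        have "card f = 2" using simple fE(1) by blast
        then obtain z where z: "f = {t e, z}" "z \<noteq> t e" using edge_endpoints[OF _ f(2)] by blast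
        then obtain g where g: "g \<in> ?M" "z \<in> g" using fE by blast
        have "z \<in> nbrs E (t e)" using z fE by (simp add: nbrs_def)
        then have "e = g" using same[of e g z] e g by auto
        moreover have "card e = 2" using simple e by blast
        then obtain w where "e = {t e, w}" using edge_endpoints[OF _ te] by blast
        ultimately show ?thesis using z g by auto
      qed
      then have "{f \<in> ?I. t e \<in> f} = {e}" using eI te by blast
      then have "vdegree ?I (t e) = 1" by (simp add: vdegree_def)
      then show ?thesis using eI te by (auto simp: pendant_def)
    qed
    ultimately show ?thesis by (simp add: semistrong_matching_def)
  qed
  then show ?thesis using c(1) by (auto simp: semistrong_edge_coloring_def)
qed

lemma proper_on_insert:
  assumes "proper_on E t A c" "A \<subseteq> E" "e \<in> E" "e \<notin> A" "k \<notin> c ` (conflicts E t e \<inter> A)"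
  shows "proper_on E t (insert e A) (c(e := k))"
proof -
  have "f \<in> conflicts E t e" if "f \<in> A" "e \<in> conflicts E t f" for f
    using conflicts_sym[of f E e t] that assms(2) by blast
  moreover have "e \<notin> conflicts E t e" by (simp add: conflicts_def)
  ultimately show ?thesis using assms unfolding proper_on_def by (auto 4 3)
qed

lemma greedy_step:
  assumes "proper_on E t A c" "A \<subseteq> E" "e \<in> E" "e \<notin> A" "finite E" "c ` A \<subseteq> {..<N}"
    and "card (conflicts E t e \<inter> A) < N"
  shows "\<exists>k<N. proper_on E t (insert e A) (c(e := k)) \<and> (c(e := k)) ` insert e A \<subseteq> {..<N}"
proof -
  let ?C = "conflicts E t e \<inter> A"
  have "finite ?C" using assms(2,5) by (meson finite_Int finite_subset)
  then have "finite (c ` ?C)" "card (c ` ?C) < card {..<N}"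
    using assms(7) card_image_le[of ?C c] by auto
  then have "\<not> {..<N} \<subseteq> c ` ?C" using card_mono by (metis leD)
  then obtain k where "k < N" "k \<notin> c ` ?C" by blast
  then show ?thesis using proper_on_insert[OF assms(1-4)] assms(4,6) by (intro exI[of _ k]) auto
qed

lemma tail_colorable_empty: "tail_colorable {} s N"
  by (simp add: tail_colorable_def valid_tails_def proper_on_def outs_def excess_def)

text \<open>A list coloring of the complete graph on four vertices minus the edge between the two vertices
  with lists \<open>B1\<close> and \<open>B2\<close>, each list being at least as long as the degree. If \<open>B1\<close> and \<open>B2\<close> share a color, use
  it for both. Otherwise their union has at least four colors, and unless \<open>A1\<close> is also that long, one
  of them is missing in \<open>A1\<close>. In all cases two colors
  of \<open>A1\<close> remain, so a color can be chosen from \<open>A2\<close> and then another one from \<open>A1\<close>.\<close>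

lemma four_lists:
  fixes A1 A2 B1 B2 :: "nat set"
  assumes fin: "finite A1" "finite A2" "finite B1" "finite B2"
    and A: "3 \<le> card A1" "3 \<le> card A2" and B: "2 \<le> card B1" "2 \<le> card B2"
  obtains \<alpha>1 \<alpha>2 \<beta>1 \<beta>2 where "\<alpha>1 \<in> A1" "\<alpha>2 \<in> A2" "\<beta>1 \<in> B1" "\<beta>2 \<in> B2"
    "\<alpha>1 \<noteq> \<alpha>2" "{\<alpha>1, \<alpha>2} \<inter> {\<beta>1, \<beta>2} = {}"
proof -
  note found = that
  have nonempty: "\<exists>x\<in>S. x \<notin> D" if "finite D" "card D < card S" for S D :: "nat set"
    using that by (meson card_mono leD subsetI)
  have finish: thesis if b: "\<beta>1 \<in> B1" "\<beta>2 \<in> B2" "2 \<le> card (A1 - {\<beta>1, \<beta>2})" for \<beta>1 \<beta>2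
  proof -
    have "card {\<beta>1, \<beta>2} < card A2" using A(2) by (auto simp: card_insert_if)
    then obtain y where y: "y \<in> A2" "y \<notin> {\<beta>1, \<beta>2}" using nonempty[of "{\<beta>1, \<beta>2}" A2] by auto
    obtain x where x: "x \<in> A1 - {\<beta>1, \<beta>2}" "x \<notin> {y}"
      using nonempty[of "{y}" "A1 - {\<beta>1, \<beta>2}"] b(3) by auto
    show thesis using found[of x y \<beta>1 \<beta>2] x y b by auto
  qed
  have minus1: "2 \<le> card (A1 - {b})" for b
  proof -
    have "card A1 - 1 \<le> card (A1 - {b})" by (simp add: card_Diff_singleton_if)
    then show ?thesis using A(1) by linarith
  qed
  obtain b1 b2 where b: "b1 \<in> B1" "b2 \<in> B2" using B by (metis card.empty ex_in_conv not_numeral_le_zero)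
  show thesis
  proof (cases "B1 \<inter> B2 = {}")
    case False
    then obtain b where "b \<in> B1" "b \<in> B2" by blast
    then show ?thesis using finish[of b b] minus1[of b] by simp
  next
    case True
    show ?thesis
    proof (cases "B1 \<union> B2 \<subseteq> A1")
      case True
      have "4 \<le> card (B1 \<union> B2)" using card_Un_disjoint[OF fin(3,4) \<open>B1 \<inter> B2 = {}\<close>] B by simp
      then have "4 \<le> card A1" using card_mono[OF fin(1) True] by simp
      moreover have "card A1 - card {b1, b2} \<le> card (A1 - {b1, b2})" by (rule diff_card_le_card_Diff) simp
      moreover have "card {b1, b2} \<le> 2" by (simp add: card_insert_if)
      ultimately have "2 \<le> card (A1 - {b1, b2})" by linarith
      then show ?thesis using finish b by blast
    next
      case False
      then consider x where "x \<in> B1" "x \<notin> A1" | x where "x \<in> B2" "x \<notin> A1" by blast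
      then show ?thesis
      proof cases
        case 1
        then have "A1 - {x, b2} = A1 - {b2}" by blast
        then show ?thesis using finish[of x b2] minus1[of b2] 1 b by simp
      next
        case 2
        then have "A1 - {b1, x} = A1 - {b1}" by blast
        then show ?thesis using finish[of b1 x] minus1[of b1] 2 b by simp
      qed
    qed
  qed
qed

text \<open>The bound \<open>K\<close> need not be attained, so that the number of colors stays the same for all induced
  subgraphs.\<close>

locale bounded_graph =
  fixes V :: "'a set" and E :: "'a set set" and K :: nat
  assumes simple: "simple_graph V E" and deg_le: "\<And>v. vdegree E v \<le> K"
begin

lemma card_edge: "e \<in> E \<Longrightarrow> card e = 2"
  using simple by (simp add: simple_graph_def)

lemma finE: "finite E"
proof -
  have "E \<subseteq> Pow V" "finite V" using simple by (auto simp: simple_graph_def)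
  then show ?thesis by (meson finite_Pow_iff finite_subset)
qed

lemma edge_other:
  assumes "e \<in> E" "v \<in> e"
  obtains w where "e = {v, w}" "w \<noteq> v" "w \<in> nbrs E v"
proof -
  obtain w where "e = {v, w}" "w \<noteq> v"
    using edge_endpoints[OF card_edge[OF assms(1)] assms(2)] by blast
  then show thesis using that assms by (simp add: nbrs_def)
qed

lemma nbr_sym: "w \<in> nbrs E v \<longleftrightarrow> v \<in> nbrs E w"
  by (simp add: nbrs_def insert_commute)

lemma nbr_neq: "w \<in> nbrs E v \<Longrightarrow> w \<noteq> v"
  using card_edge[of "{v, w}"] by (auto simp: nbrs_def)

lemma star_eq: "star E v = (\<lambda>w. {v, w}) ` nbrs E v"
proof
  show "star E v \<subseteq> (\<lambda>w. {v, w}) ` nbrs E v"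
  proof
    fix e assume "e \<in> star E v"
    then obtain w where "e = {v, w}" "w \<in> nbrs E v" by (auto simp: star_def elim: edge_other)
    then show "e \<in> (\<lambda>w. {v, w}) ` nbrs E v" by blast
  qed
qed (auto simp: star_def nbrs_def)

lemma card_star: "card (star E v) = card (nbrs E v)" and finite_nbrs: "finite (nbrs E v)"
  and finite_star: "finite (star E v)"
proof -
  have inj: "inj_on (\<lambda>w. {v, w}) (nbrs E v)" by (auto simp: inj_on_def doubleton_eq_iff)
  show "finite (star E v)" using finE by (simp add: star_def)
  then show "finite (nbrs E v)" using inj star_eq by (metis finite_imageD)
  show "card (star E v) = card (nbrs E v)" using inj star_eq by (simp add: card_image)
qed

lemma vdegree_eq: "vdegree E v = card (nbrs E v)"
  using card_star by (simp add: vdegree_def star_def)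

lemma card_nbrs_le: "card (nbrs E v) \<le> K" and card_star_le: "card (star E v) \<le> K"
  using deg_le[of v] by (simp_all add: vdegree_eq card_star)

text \<open>The conflicts of an edge from \<open>u\<close> to \<open>v\<close> that are caused by its head: the other edges at \<open>v\<close>,
  and the edges whose tail is another neighbor of \<open>v\<close>.\<close>

definition near_head :: "('a set \<Rightarrow> 'a) \<Rightarrow> 'a \<Rightarrow> 'a \<Rightarrow> 'a set set" where
  "near_head t v u = (\<Union>w\<in>nbrs E v - {u}. insert {v, w} (outs E t w))"

lemma finite_outs: "finite (outs E t v)" using finE by (simp add: outs_def)

lemma finite_near_head: "finite (near_head t v u)"
  using finite_nbrs finite_outs by (auto simp: near_head_def)

text \<open>The three parts on the right come from the head, from the tail itself, and from the other
  neighbors of the tail.\<close>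

lemma conflicts_sub:
  assumes uv: "{u, v} \<in> E" "t {u, v} = u" and t: "\<forall>f\<in>E. t f \<in> f"
  shows "conflicts E t {u, v} \<subseteq> near_head t v u \<union> (outs E t u - {{u, v}}) \<union> (\<Union>w\<in>nbrs E u - {v}. star E w)"
proof
  fix f assume "f \<in> conflicts E t {u, v}"
  then have f: "f \<in> E" "f \<noteq> {u, v}" and "f \<inter> nbrs E u \<noteq> {} \<or> {u, v} \<inter> nbrs E (t f) \<noteq> {}"
    using uv by (auto simp: conflicts_def)
  then consider z where "z \<in> f" "z \<in> nbrs E u" | "t f \<in> nbrs E v"
    using t f(1) nbr_sym by blast
  then show "f \<in> near_head t v u \<union> (outs E t u - {{u, v}}) \<union> (\<Union>w\<in>nbrs E u - {v}. star E w)"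
  proof cases
    case 1
    show ?thesis
    proof (cases "z = v")
      case True
      then obtain w where w: "f = {v, w}" "w \<in> nbrs E v" using edge_other[OF f(1)] 1 by metis
      then have "w \<noteq> u" using f by (auto simp: insert_commute)
      then show ?thesis using w by (auto simp: near_head_def)
    next
      case False
      then show ?thesis using 1 f by (auto simp: star_def)
    qed
  next
    case 2
    then show ?thesis using f by (auto simp: near_head_def outs_def)
  qed
qed

text \<open>A neighbor of \<open>v\<close> contributes its edge to \<open>v\<close> and the edges whose tail it is. These are three
  edges only if the edge to \<open>v\<close> has tail \<open>v\<close> and the neighbor is the tail of two edges, that is, if the
  edge to \<open>v\<close> belongs to the excess of \<open>v\<close>.\<close>

lemma card_near_head:
  assumes t: "valid_tails E t s" and u: "u \<in> nbrs E v"
  shows "card (near_head t v u) \<le> 2 * (card (nbrs E v) - 1) + card (excess E t v)"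
proof -
  let ?N = "nbrs E v - {u}"
  let ?X = "{w \<in> ?N. {v, w} \<in> excess E t v}"
  have finN: "finite ?N" using finite_nbrs by blast
  have each: "card (insert {v, w} (outs E t w)) \<le> 2 + of_bool (w \<in> ?X)" if w: "w \<in> ?N" for w
  proof (cases "{v, w} \<in> outs E t w")
    case True
    then have "card (insert {v, w} (outs E t w)) \<le> 2"
      using t by (simp add: insert_absorb valid_tails_def)
    then show ?thesis by linarith
  next
    case False
    have vw: "{v, w} \<in> E" using w by (simp add: nbrs_def)
    then have tv: "t {v, w} = v" using t False by (auto simp: valid_tails_def outs_def)
    have two: "card (outs E t w) \<le> 2" using t by (simp add: valid_tails_def)
    show ?thesis
    proof (cases "card (outs E t w) = 2")
      case True
      then have "w \<in> ?X" using w vw tv nbr_neq[of w v] by (auto simp: excess_def outs_def)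
      then show ?thesis using two finite_outs False by simp
    next
      case False
      then show ?thesis using two finite_outs card_insert_le_m1[of 2 "outs E t w"]
        by (simp add: card_insert_if)
    qed
  qed
  have "card (near_head t v u) \<le> (\<Sum>w\<in>?N. card (insert {v, w} (outs E t w)))"
    unfolding near_head_def by (rule card_UN_le[OF finN])
  also have "\<dots> \<le> (\<Sum>w\<in>?N. 2 + of_bool (w \<in> ?X))" by (rule sum_mono) (rule each)
  also have "\<dots> = (\<Sum>w\<in>?N. 2) + (\<Sum>w\<in>?N. of_bool (w \<in> ?X))" by (rule sum.distrib)
  also have "(\<Sum>w\<in>?N. of_bool (w \<in> ?X)) = card (?N \<inter> {w. w \<in> ?X})"
    by (rule trans[OF sum_of_bool_eq of_nat_id]) (rule finN)+
  also have "?N \<inter> {w. w \<in> ?X} = ?X" by blast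
  also have "card ?X \<le> card (excess E t v)"
  proof (rule card_inj_on_le[of "\<lambda>w. {v, w}"])
    show "inj_on (\<lambda>w. {v, w}) ?X" by (auto simp: inj_on_def doubleton_eq_iff)
    show "finite (excess E t v)" using finite_outs by (simp add: excess_def)
  qed auto
  finally show ?thesis using u finite_nbrs[of v] by simp
qed

text \<open>Here \<open>A\<close> is the set of edges colored so far, and \<open>R\<close> collects the conflicts that are due to
  the tail \<open>u\<close> and to its neighbors other than the head \<open>v\<close>.\<close>

lemma card_conflicts_le:
  assumes t: "valid_tails E t s" and e: "e = {u, v}" and uv: "e \<in> E" "t e = u"
    and d: "card (nbrs E v) \<le> d" and m: "card (excess E t v) \<le> m"
    and R: "finite R" "A \<inter> (outs E t u - {e}) \<subseteq> R"
      "\<And>w. w \<in> nbrs E u \<Longrightarrow> w \<noteq> v \<Longrightarrow> A \<inter> star E w \<subseteq> R"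
  shows "card (conflicts E t e \<inter> A) \<le> 2 * (d - 1) + m + card R"
proof -
  have sub: "conflicts E t e \<subseteq>
      near_head t v u \<union> (outs E t u - {e}) \<union> (\<Union>w\<in>nbrs E u - {v}. star E w)"
    unfolding e by (rule conflicts_sub) (use uv t in \<open>simp_all add: valid_tails_def e\<close>)
  have "conflicts E t e \<inter> A \<subseteq> near_head t v u \<union> R"
  proof
    fix f assume f: "f \<in> conflicts E t e \<inter> A"
    then consider "f \<in> near_head t v u" | "f \<in> outs E t u - {e}"
      | w where "w \<in> nbrs E u" "w \<noteq> v" "f \<in> star E w" using sub by blast
    then show "f \<in> near_head t v u \<union> R" using f R(2,3) by cases blast+
  qed
  then have "card (conflicts E t e \<inter> A) \<le> card (near_head t v u \<union> R)"
    using finite_near_head R(1) by (intro card_mono) auto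
  also have "\<dots> \<le> card (near_head t v u) + card R" by (rule card_Un_le)
  also have "card (near_head t v u) \<le> 2 * (card (nbrs E v) - 1) + card (excess E t v)"
    by (rule card_near_head[OF t]) (use uv in \<open>simp add: nbrs_def insert_commute e\<close>)
  finally show ?thesis using d m by linarith
qed

definition del :: "'a set \<Rightarrow> 'a set set" where
  "del X = {e \<in> E. e \<inter> X = {}}"

lemma del_Un_stars: "E = del X \<union> (\<Union>x\<in>X. star E x)"
  by (auto simp: del_def star_def)

text \<open>Tails and colors carry over from the graph without \<open>X\<close> if each new edge gets its tail in \<open>X\<close>.
  Then no new edge has an old tail, so the invariants at old vertices are kept; and two old edges
  conflict in \<open>E\<close> only if they did before, because an edge that joins them avoids \<open>X\<close>. This is
  why vertices, not edges, are deleted.\<close>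

lemma extend_tails:
  assumes t0: "valid_tails (del X) t0 s" "proper_on (del X) t0 (del X) c"
    and old: "\<And>e. e \<in> del X \<Longrightarrow> t e = t0 e"
    and new: "\<And>e x. x \<in> X \<Longrightarrow> e \<in> star E x \<Longrightarrow> t e \<in> e \<inter> X"
    and outs: "\<And>x. x \<in> X \<Longrightarrow> card (outs E t x) \<le> 2"
    and exc: "\<And>x. x \<in> X \<Longrightarrow> card (excess E t x) \<le> s"
  shows "valid_tails E t s" "proper_on E t (del X) c"
proof -
  have outs_eq: "outs E t v = outs (del X) t0 v" if "v \<notin> X" for v
    using that old new by (fastforce simp: outs_def del_def star_def)
  have mem: "\<forall>e\<in>E. t e \<in> e"
  proof
    fix e assume "e \<in> E"
    then show "t e \<in> e"
      using new[of _ e] old[of e] t0(1) by (cases "e \<in> del X") (auto simp: del_def star_def valid_tails_def)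
  qed
  have exc_eq: "excess E t v = excess (del X) t0 v" if v: "v \<notin> X" for v
  proof -
    have "outs E t w = outs (del X) t0 w" if "e \<in> outs (del X) t0 v" "w \<in> e" for e w
      using outs_eq[of w] that by (auto simp: outs_def del_def)
    then show ?thesis using outs_eq[OF v] by (auto simp: excess_def)
  qed
  show "valid_tails E t s"
    using t0(1) mem outs exc outs_eq exc_eq unfolding valid_tails_def by metis
  have "f \<in> conflicts (del X) t0 e" if e: "e \<in> del X" and f: "f \<in> del X" "f \<in> conflicts E t e" for e f
  proof -
    have "h \<inter> nbrs (del X) (t0 g) \<noteq> {}" if "h \<inter> nbrs E (t g) \<noteq> {}" "g \<in> del X" "h \<in> del X" for g h
    proof -
      obtain z where z: "z \<in> h" "{t g, z} \<in> E" using \<open>h \<inter> nbrs E (t g) \<noteq> {}\<close> by (auto simp: nbrs_def)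
      have "t g \<in> g" "t g = t0 g" using mem old \<open>g \<in> del X\<close> by (auto simp: del_def)
      then have "{t0 g, z} \<in> del X" using z that(2,3) by (auto simp: del_def)
      then show ?thesis using z by (auto simp: nbrs_def)
    qed
    then show ?thesis using e f by (auto simp: conflicts_def)
  qed
  then show "proper_on E t (del X) c" using t0(2) by (auto simp: proper_on_def)
qed

lemma color_edge:
  assumes "proper_on E t A c" "c ` A \<subseteq> {..<N}" "A \<subseteq> E" "e \<in> E" "e \<notin> A"
    and "card (conflicts E t e \<inter> A) < N"
  obtains c' where "proper_on E t (insert e A) c'" "c' ` insert e A \<subseteq> {..<N}"
  using greedy_step[OF assms(1,3,4,5) finE assms(2,6)] by (elim exE conjE) (rule that)

lemma outs_sub_stars:
  assumes "valid_tails (del X) t0 s" "\<And>e. e \<in> del X \<Longrightarrow> t e = t0 e" "x \<in> X"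
  shows "outs E t x \<subseteq> (\<Union>x\<in>X. star E x)"
proof
  fix e assume e: "e \<in> outs E t x"
  have "e \<notin> del X"
  proof
    assume "e \<in> del X"
    then have "t0 e \<in> e" "t e = t0 e" "e \<inter> X = {}"
      using assms(1,2) by (auto simp: valid_tails_def del_def)
    then show False using e assms(3) by (auto simp: outs_def)
  qed
  then show "e \<in> (\<Union>x\<in>X. star E x)" using e by (auto simp: outs_def del_def star_def)
qed

lemma excess_sub: "excess E t v \<subseteq> outs E t v"
  by (auto simp: excess_def)

lemma not_excess:
  assumes "card (outs E t w) \<le> 1"
  shows "{v, w} \<notin> excess E t v"
  using assms by (auto simp: excess_def)

lemma card_sub_singleton: "A \<subseteq> {a} \<Longrightarrow> card A \<le> 1"
  using card_mono[of "{a}" A] by simp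

lemma card_sub_doubleton: "A \<subseteq> {a, b} \<Longrightarrow> card A \<le> 2"
  using card_mono[of "{a, b}" A] by (simp add: card_insert_if split: if_splits)

section \<open>Reducible configurations\<close>

lemma colorable_isolated:
  assumes "nbrs E u = {}" "tail_colorable (del {u}) s N"
  shows "tail_colorable E s N"
proof -
  have "E = del {u}" using del_Un_stars[of "{u}"] star_eq[of u] assms(1) by simp
  then show ?thesis using assms(2) by simp
qed

text \<open>The leaf is the tail, so all conflicts are near the head; each of the at most \<open>K - 1\<close> other
  neighbors of the head accounts for two of them, up to an excess of \<open>s\<close>.\<close>

lemma colorable_leaf:
  assumes u: "nbrs E u = {v}" and s: "1 \<le> s" "s \<le> 2" and N: "2 * K < N"
    and col: "tail_colorable (del {u}) s N"
  shows "tail_colorable E s N"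
proof -
  obtain t0 c where c: "valid_tails (del {u}) t0 s" "c ` del {u} \<subseteq> {..<N}"
    "proper_on (del {u}) t0 (del {u}) c"
    using col unfolding tail_colorable_def by blast
  define t where "t = t0({u, v} := u)"
  have star: "star E u = {{u, v}}" using star_eq[of u] u by simp
  have uv: "{u, v} \<in> E" "{u, v} \<notin> del {u}" using star by (auto simp: star_def del_def)
  have sub: "del {u} \<subseteq> E" by (auto simp: del_def)
  have E: "E = insert {u, v} (del {u})" using del_Un_stars[of "{u}"] star by simp
  have new: "t e \<in> e \<inter> {u}" if "x \<in> {u}" "e \<in> star E x" for e x using that star by (auto simp: t_def)
  have old: "t e = t0 e" if "e \<in> del {u}" for e using that uv by (auto simp: t_def)
  have o: "outs E t u \<subseteq> {{u, v}}" using outs_sub_stars[OF c(1) old, of u] star by simp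
  have o: "card (outs E t u) \<le> 1" "card (excess E t u) \<le> 1"
    by (rule card_sub_singleton[OF o], rule card_sub_singleton[OF order_trans[OF excess_sub o]])
  have t: "valid_tails E t s" "proper_on E t (del {u}) c"
  proof -
    have o2: "card (outs E t x) \<le> 2" "card (excess E t x) \<le> s" if "x \<in> {u}" for x
      using that o s by auto
    show "valid_tails E t s" "proper_on E t (del {u}) c"
      by (rule extend_tails[OF c(1,3) old new o2]; assumption)+
  qed
  have K: "1 \<le> K" using card_nbrs_le[of u] u by simp
  have "card (conflicts E t {u, v} \<inter> del {u}) \<le> 2 * (K - 1) + s + card ({} :: 'a set set)"
    by (rule card_conflicts_le[OF t(1) refl uv(1)])
      (use u t(1) card_nbrs_le in \<open>auto simp: t_def outs_def del_def valid_tails_def\<close>)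
  then have "card (conflicts E t {u, v} \<inter> del {u}) < N" using K s N by simp
  then obtain c' where "proper_on E t (insert {u, v} (del {u})) c'"
      "c' ` insert {u, v} (del {u}) \<subseteq> {..<N}"
    using color_edge[OF t(2) c(2) sub uv] by blast
  then show ?thesis using t(1) E unfolding tail_colorable_def by auto
qed

text \<open>Here \<open>x\<close> is the tail of both edges. The edge to \<open>b\<close> may have \<open>2 * (K - 1) + 2\<close> conflicts near
  \<open>b\<close> and three at \<open>a\<close>, which is just below the number of colors. The edge to \<open>a\<close> is colored
  before it; it has at most six conflicts near \<open>a\<close>, and all others are edges at \<open>b\<close>.\<close>

lemma colorable_two_three:
  assumes x: "nbrs E x = {a, b}" "a \<noteq> b" and a: "card (nbrs E a) \<le> 3"
    and col: "tail_colorable (del {x}) 2 (2 * K + 4)"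
  shows "tail_colorable E 2 (2 * K + 4)"
proof -
  obtain t0 c where c: "valid_tails (del {x}) t0 2" "c ` del {x} \<subseteq> {..<2 * K + 4}"
    "proper_on (del {x}) t0 (del {x}) c"
    using col unfolding tail_colorable_def by blast
  define t where "t = t0({x, a} := x, {x, b} := x)"
  have star: "star E x = {{x, a}, {x, b}}" using star_eq[of x] x by auto
  have mem: "{x, a} \<in> E" "{x, b} \<in> E" "{x, a} \<notin> del {x}" "{x, b} \<notin> del {x}"
    using star by (auto simp: star_def del_def)
  have neq: "{x, a} \<noteq> {x, b}" using x(2) by (auto simp: doubleton_eq_iff)
  have sub: "del {x} \<subseteq> E" by (auto simp: del_def)
  have E: "E = insert {x, b} (insert {x, a} (del {x}))" using del_Un_stars[of "{x}"] star by auto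
  have tx: "t {x, a} = x" "t {x, b} = x" by (auto simp: t_def)
  have new: "t e \<in> e \<inter> {x}" if "z \<in> {x}" "e \<in> star E z" for e z
    using that star tx by auto
  have old: "t e = t0 e" if "e \<in> del {x}" for e using that mem by (auto simp: t_def)
  have o: "outs E t x \<subseteq> {{x, a}, {x, b}}" using outs_sub_stars[OF c(1) old, of x] star by simp
  have o2: "card (outs E t z) \<le> 2" "card (excess E t z) \<le> 2" if "z \<in> {x}" for z
    using card_sub_doubleton[OF o] card_sub_doubleton[OF order_trans[OF excess_sub o]] that by simp_all
  have t: "valid_tails E t 2" "proper_on E t (del {x}) c"
    by (rule extend_tails[OF c(1,3) old new o2]; assumption)+
  have exc: "card (excess E t v) \<le> 2" for v using t(1) by (simp add: valid_tails_def)
  have K: "2 \<le> K" using card_nbrs_le[of x] x by simp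
  have R: "card (star E b - {{x, b}}) \<le> K - 1" "finite (star E b - {{x, b}})"
    using card_star_le[of b] mem(2) finite_star[of b] by (auto simp: star_def)
  have "card (conflicts E t {x, a} \<inter> del {x}) \<le> 2 * (3 - 1) + 2 + card (star E b - {{x, b}})"
    by (rule card_conflicts_le[OF t(1) refl mem(1) tx(1) a exc R(2)]) (use x o mem in auto)
  then have "card (conflicts E t {x, a} \<inter> del {x}) < 2 * K + 4" using R(1) K by simp
  then obtain c1 where c1: "proper_on E t (insert {x, a} (del {x})) c1"
      "c1 ` insert {x, a} (del {x}) \<subseteq> {..<2 * K + 4}"
    using color_edge[OF t(2) c(2) sub mem(1,3)] by blast
  let ?A = "insert {x, a} (del {x})"
  have "card (conflicts E t {x, b} \<inter> ?A) \<le> 2 * (K - 1) + 2 + card (star E a)"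
    by (rule card_conflicts_le[OF t(1) refl mem(2) tx(2) card_nbrs_le exc finite_star])
      (use x o mem in \<open>auto simp: star_def\<close>)
  then have "card (conflicts E t {x, b} \<inter> ?A) < 2 * K + 4"
    using a card_star[of a] K by simp
  moreover have A: "?A \<subseteq> E" "{x, b} \<notin> ?A" using sub mem neq by auto
  ultimately obtain c2 where "proper_on E t (insert {x, b} ?A) c2"
      "c2 ` insert {x, b} ?A \<subseteq> {..<2 * K + 4}"
    using color_edge[OF c1 A(1) mem(2) A(2)] by blast
  then show ?thesis using t(1) E unfolding tail_colorable_def by auto
qed

text \<open>The edge between \<open>b\<close> and \<open>x\<close> is the one with few conflicts, so it is colored last. Its tail is
  \<open>b\<close>, which then has two edges with tail \<open>b\<close>; as \<open>x\<close> is the tail of one edge only, the excess at \<open>b\<close>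
  is at most one.\<close>

lemma colorable_two_two:
  assumes x: "nbrs E x = {a, b}" "a \<noteq> b" and b: "nbrs E b = {x, y}" "y \<noteq> x"
    and col: "tail_colorable (del {x, b}) 1 (2 * K + 2)"
  shows "tail_colorable E 1 (2 * K + 2)"
proof -
  obtain t0 c where c: "valid_tails (del {x, b}) t0 1" "c ` del {x, b} \<subseteq> {..<2 * K + 2}"
    "proper_on (del {x, b}) t0 (del {x, b}) c"
    using col unfolding tail_colorable_def by blast
  have ne: "x \<noteq> a" "x \<noteq> b" "b \<noteq> y" using nbr_neq x b by auto
  let ?xa = "{x, a}" and ?xb = "{b, x}" and ?by = "{b, y}"
  define t where "t = t0(?xa := x, ?xb := b, ?by := b)"
  have star: "star E x = {?xa, ?xb}" "star E b = {?xb, ?by}"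
    using star_eq[of x] star_eq[of b] x b by auto
  have mem: "?xa \<in> E" "?xb \<in> E" "?by \<in> E"
    "?xa \<notin> del {x, b}" "?xb \<notin> del {x, b}" "?by \<notin> del {x, b}"
    using star by (auto simp: star_def del_def)
  have neq: "?xa \<noteq> ?xb" "?xa \<noteq> ?by" "?xb \<noteq> ?by"
    using x(2) b(2) ne by (auto simp: doubleton_eq_iff)
  have sub: "del {x, b} \<subseteq> E" by (auto simp: del_def)
  have E: "E = insert ?xb (insert ?xa (insert ?by (del {x, b})))"
    using del_Un_stars[of "{x, b}"] star by auto
  have tx: "t ?xa = x" "t ?xb = b" "t ?by = b" using neq by (auto simp: t_def)
  have new: "t e \<in> e \<inter> {x, b}" if "z \<in> {x, b}" "e \<in> star E z" for e z
    using that star tx by auto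
  have old: "t e = t0 e" if "e \<in> del {x, b}" for e using that mem by (auto simp: t_def)
  have "outs E t z \<subseteq> {?xa, ?xb, ?by}" if "z \<in> {x, b}" for z
    using outs_sub_stars[OF c(1) old that] star by auto
  then have o: "outs E t x \<subseteq> {?xa}" "outs E t b \<subseteq> {?xb, ?by}"
    using tx ne by (fastforce simp: outs_def)+
  have ox: "card (outs E t x) \<le> 1" using card_sub_singleton[OF o(1)] .
  have "?xb \<notin> excess E t b" using not_excess[OF ox] .
  then have "excess E t b \<subseteq> {?by}" using o(2) excess_sub[of t b] by blast
  then have o2: "card (outs E t z) \<le> 2" "card (excess E t z) \<le> 1" if "z \<in> {x, b}" for z
    using that ox card_sub_doubleton[OF o(2)] card_sub_singleton[OF order_trans[OF excess_sub o(1)]]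
      card_sub_singleton[of "excess E t b" ?by] by auto
  have t: "valid_tails E t 1" "proper_on E t (del {x, b}) c"
    by (rule extend_tails[OF c(1,3) old new o2]; assumption)+
  have exc: "card (excess E t v) \<le> 1" for v using t(1) by (simp add: valid_tails_def)
  have K: "2 \<le> K" using card_nbrs_le[of x] x by simp
  have "card (conflicts E t ?by \<inter> del {x, b}) \<le> 2 * (K - 1) + 1 + card ({} :: 'a set set)"
    by (rule card_conflicts_le[OF t(1) refl mem(3) tx(3) card_nbrs_le exc]) (use b o mem star in auto)
  then have "card (conflicts E t ?by \<inter> del {x, b}) < 2 * K + 2" using K by simp
  then obtain c1 where c1: "proper_on E t (insert ?by (del {x, b})) c1"
      "c1 ` insert ?by (del {x, b}) \<subseteq> {..<2 * K + 2}"
    using color_edge[OF t(2) c(2) sub mem(3,6)] by blast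
  let ?A = "insert ?by (del {x, b})"
  have A: "?A \<subseteq> E" "?xa \<notin> ?A" using sub mem neq by auto
  have "card (conflicts E t ?xa \<inter> ?A) \<le> 2 * (K - 1) + 1 + card {?by}"
    by (rule card_conflicts_le[OF t(1) refl mem(1) tx(1) card_nbrs_le exc]) (use x o mem star in auto)
  then have "card (conflicts E t ?xa \<inter> ?A) < 2 * K + 2" using K by simp
  then obtain c2 where c2: "proper_on E t (insert ?xa ?A) c2" "c2 ` insert ?xa ?A \<subseteq> {..<2 * K + 2}"
    using color_edge[OF c1 A(1) mem(1) A(2)] by blast
  let ?A' = "insert ?xa ?A"
  have A': "?A' \<subseteq> E" "?xb \<notin> ?A'" using A mem neq by auto
  have dx: "card (nbrs E x) \<le> 2" using x by simp
  have ry: "?by \<in> star E y" using mem by (auto simp: star_def)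
  have "card (conflicts E t ?xb \<inter> ?A') \<le> 2 * (2 - 1) + 1 + card (star E y)"
    by (rule card_conflicts_le[OF t(1) refl mem(2) tx(2) dx exc finite_star]) (use b o ry in auto)
  then have "card (conflicts E t ?xb \<inter> ?A') < 2 * K + 2" using K card_star_le[of y] by simp
  then obtain c3 where "proper_on E t (insert ?xb ?A') c3" "c3 ` insert ?xb ?A' \<subseteq> {..<2 * K + 2}"
    using color_edge[OF c2 A'(1) mem(2) A'(2)] by blast
  then show ?thesis using t(1) E unfolding tail_colorable_def by auto
qed

text \<open>The edges at \<open>x1\<close> and \<open>x2\<close> have their tails there, and the third edge at \<open>a\<close> has tail \<open>a\<close>. That
  edge is colored first. Among the other four, the two edges that lead away from \<open>a\<close> have no conflict
  with each other, which uses \<open>b1 \<noteq> b2\<close>; so they form the graph of lemma \<open>four_lists\<close>. Their lists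
  have at least two colors thanks to the excess bound \<open>1\<close>, and the edges at \<open>a\<close> have at least
  \<open>K \<ge> 3\<close>. For \<open>K = 3\<close> a greedy coloring could run out of colors at the last edge.\<close>

lemma colorable_three:
  assumes a: "nbrs E a = {x1, x2, y}" "x1 \<noteq> x2" "x1 \<noteq> y" "x2 \<noteq> y"
    and x1: "nbrs E x1 = {a, b1}" "b1 \<noteq> a" and x2: "nbrs E x2 = {a, b2}" "b2 \<noteq> a"
    and b: "b1 \<noteq> b2" "b1 \<noteq> x2" "b2 \<noteq> x1"
    and col: "tail_colorable (del {a, x1, x2}) 1 (2 * K + 2)"
  shows "tail_colorable E 1 (2 * K + 2)"
proof -
  let ?N = "2 * K + 2" and ?X = "{a, x1, x2}"
  obtain t0 c where c: "valid_tails (del ?X) t0 1" "c ` del ?X \<subseteq> {..<?N}"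
    "proper_on (del ?X) t0 (del ?X) c"
    using col unfolding tail_colorable_def by blast
  have ne: "a \<noteq> x1" "a \<noteq> x2" "a \<noteq> y" "x1 \<noteq> b1" "x2 \<noteq> b2" 
    using nbr_neq[of x1 a] nbr_neq[of x2 a] nbr_neq[of y a] nbr_neq[of b1 x1] nbr_neq[of b2 x2]
    unfolding a(1) x1(1) x2(1) by simp_all
  define e0 e1 e2 f1 f2
    where e0: "e0 = {a, y}" and e1: "e1 = {x1, a}" and e2: "e2 = {x2, a}"
      and f1: "f1 = {x1, b1}" and f2: "f2 = {x2, b2}"
  note es = e0 e1 e2 f1 f2
  define t where "t = t0(e0 := a, e1 := x1, e2 := x2, f1 := x1, f2 := x2)"
  have star: "star E a = {e1, e2, e0}" "star E x1 = {e1, f1}" "star E x2 = {e2, f2}"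
    using star_eq[of a] star_eq[of x1] star_eq[of x2] unfolding a(1) x1(1) x2(1) es
    by (simp_all add: insert_commute[of a x1] insert_commute[of a x2])
  have "star E z \<subseteq> E" for z by (auto simp: star_def)
  from this[of a] this[of x1] this[of x2]
  have mem: "e0 \<in> E" "e1 \<in> E" "e2 \<in> E" "f1 \<in> E" "f2 \<in> E"
    unfolding star by simp_all
  have notdel: "e0 \<notin> del ?X" "e1 \<notin> del ?X" "e2 \<notin> del ?X" "f1 \<notin> del ?X" "f2 \<notin> del ?X"
    by (auto simp: del_def es)
  have neq: "distinct [e0, e1, e2, f1, f2]"
    using a x1 x2 b ne by (simp add: es doubleton_eq_iff)
  have sub: "del ?X \<subseteq> E" by (auto simp: del_def)
  have E: "E = insert e2 (insert e1 (insert f2 (insert f1 (insert e0 (del ?X)))))"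
    using del_Un_stars[of ?X] star by auto
  have tx: "t e0 = a" "t e1 = x1" "t e2 = x2" "t f1 = x1" "t f2 = x2"
    using neq by (simp_all add: t_def)
  have new: "t e \<in> e \<inter> ?X" if "z \<in> ?X" "e \<in> star E z" for e z
    using that star tx by (auto simp: es)
  have old: "t e = t0 e" if "e \<in> del ?X" for e using that notdel by (auto simp: t_def)
  have os: "outs E t z \<subseteq> {e0, e1, e2, f1, f2}" if "z \<in> ?X" for z
    using outs_sub_stars[OF c(1) old that] star by auto
  have o: "outs E t a \<subseteq> {e0}" "outs E t x1 \<subseteq> {e1, f1}" "outs E t x2 \<subseteq> {e2, f2}"
    using os[of a] os[of x1] os[of x2] tx ne a(2) by (fastforce simp: outs_def)+
  have oa: "card (outs E t a) \<le> 1" using card_sub_singleton[OF o(1)] .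
  have e12: "excess E t x1 \<subseteq> {f1}" "excess E t x2 \<subseteq> {f2}"
    using not_excess[OF oa, of x1] not_excess[OF oa, of x2] o(2,3) excess_sub[of t x1] excess_sub[of t x2]
    unfolding e1[symmetric] e2[symmetric] by blast+
  have o2: "card (outs E t z) \<le> 2" "card (excess E t z) \<le> 1" if "z \<in> ?X" for z
    using that oa card_sub_doubleton[OF o(2)] card_sub_doubleton[OF o(3)]
      card_sub_singleton[OF order_trans[OF excess_sub o(1)]] card_sub_singleton[OF e12(1)]
      card_sub_singleton[OF e12(2)] by auto
  have t: "valid_tails E t 1" "proper_on E t (del ?X) c"
    by (rule extend_tails[OF c(1,3) old new o2]; assumption)+
  have exc: "card (excess E t v) \<le> 1" for v using t(1) by (simp add: valid_tails_def)
  have mem_t: "\<forall>f\<in>E. t f \<in> f" using t(1) by (simp add: valid_tails_def)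
  have K: "3 \<le> K" using card_nbrs_le[of a] a by (simp add: card_insert_if)
  have "card (conflicts E t e0 \<inter> del ?X) \<le> 2 * (K - 1) + 1 + card ({} :: 'a set set)"
    by (rule card_conflicts_le[OF t(1) e0 mem(1) tx(1) card_nbrs_le exc])
      (use a(1) o notdel star in auto)
  then have "card (conflicts E t e0 \<inter> del ?X) < ?N" using K by simp
  then obtain c1 where c1: "proper_on E t (insert e0 (del ?X)) c1"
      "c1 ` insert e0 (del ?X) \<subseteq> {..<?N}"
    using color_edge[OF t(2) c(2) sub mem(1) notdel(1)] by blast
  let ?A = "insert e0 (del ?X)"
  have A: "?A \<subseteq> E" "finite ?A" "f1 \<notin> ?A" "f2 \<notin> ?A" "e1 \<notin> ?A" "e2 \<notin> ?A"
    using sub mem neq notdel finite_subset[OF sub finE] by auto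
  \<comment> \<open>The colors still possible for \<open>e\<close> after the edge \<open>e0\<close> is colored.\<close>
  define L where "L e = {..<?N} - c1 ` (conflicts E t e \<inter> ?A)" for e
  have L: "n \<le> card (L e)" if "card (conflicts E t e \<inter> ?A) + n \<le> ?N" for e n
  proof -
    have "card (c1 ` (conflicts E t e \<inter> ?A)) \<le> card (conflicts E t e \<inter> ?A)"
      using A(2) by (intro card_image_le) auto
    moreover have "card {..<?N} - card (c1 ` (conflicts E t e \<inter> ?A)) \<le> card (L e)"
      unfolding L_def using A(2) by (intro diff_card_le_card_Diff) auto
    ultimately show ?thesis using that by simp
  qed
  have Lf: "2 \<le> card (L f)" if x: "x \<in> {x1, x2}" "f = {x, b}" "f \<in> E" "t f = x"
    "nbrs E x = {a, b}" "e \<notin> A" "outs E t x \<subseteq> {e, f}" "A = insert e0 (del ?X)" for x b e f A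
  proof (rule L)
    have "card (conflicts E t f \<inter> A) \<le> 2 * (K - 1) + 1 + card {e0}"
      by (intro card_conflicts_le[OF t(1) x(2-4) card_nbrs_le exc])
        (use x(5-8) star A in auto)
    then show "card (conflicts E t f \<inter> insert e0 (del ?X)) + 2 \<le> ?N" using K x(8) by simp
  qed
  have Le: "3 \<le> card (L e)" if x: "e = {x, a}" "e \<in> E" "f \<in> star E b" "t e = x"
    "nbrs E x = {a, b}" "f \<notin> A" "outs E t x \<subseteq> {e, f}" "near_head t a x \<inter> A \<subseteq> insert e0 (outs E t y)"
    "A = insert e0 (del ?X)" for x b e f A
  proof (rule L)
    let ?R = "insert e0 (outs E t y \<union> (star E b - {f}))"
    have "conflicts E t e \<subseteq> near_head t a x \<union> (outs E t x - {e}) \<union> (\<Union>w\<in>nbrs E x - {a}. star E w)"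
      unfolding x(1) by (rule conflicts_sub) (use x(1,2,4) mem_t in simp_all)
    then have "conflicts E t e \<inter> A \<subseteq> ?R" using x(5-8) by blast
    then have "card (conflicts E t e \<inter> A) \<le> card ?R"
      using finite_outs finite_star by (intro card_mono) auto
    also have "\<dots> \<le> Suc (card (outs E t y \<union> (star E b - {f})))"
      using finite_outs finite_star by (simp add: card_insert_if)
    also have "card (outs E t y \<union> (star E b - {f})) \<le> card (outs E t y) + card (star E b - {f})"
      by (rule card_Un_le)
    also have "card (outs E t y) \<le> 2" using t(1) by (simp add: valid_tails_def)
    also have "card (star E b - {f}) \<le> K - 1"
      using card_star_le[of b] x(3) finite_star[of b] by simp
    finally show "card (conflicts E t e \<inter> insert e0 (del ?X)) + 3 \<le> ?N" using K x(9) by simp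
  qed
  have near12: "near_head t a x1 \<inter> insert e0 (del ?X) \<subseteq> insert e0 (outs E t y)"
    "near_head t a x2 \<inter> insert e0 (del ?X) \<subseteq> insert e0 (outs E t y)"
  proof -
    have "near_head t a x1 \<subseteq> {e2, f2, e0} \<union> outs E t y" "near_head t a x2 \<subseteq> {e1, f1, e0} \<union> outs E t y"
    proof -
      have "near_head t a x1 = insert {a, x2} (outs E t x2) \<union> insert {a, y} (outs E t y)"
        "near_head t a x2 = insert {a, x1} (outs E t x1) \<union> insert {a, y} (outs E t y)"
        unfolding near_head_def a(1) using a(2-4) by auto
      then show "near_head t a x1 \<subseteq> {e2, f2, e0} \<union> outs E t y" "near_head t a x2 \<subseteq> {e1, f1, e0} \<union> outs E t y"
        using o(2,3) unfolding e0[symmetric] e1[symmetric] e2[symmetric]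
          insert_commute[of a x1] insert_commute[of a x2] by blast+
    qed
    moreover have "S \<inter> B \<subseteq> insert r U" if "S \<subseteq> {p, q, r} \<union> U" "p \<notin> B" "q \<notin> B"
      for S B U :: "'a set set" and p q r
      using that by blast
    ultimately show "near_head t a x1 \<inter> insert e0 (del ?X) \<subseteq> insert e0 (outs E t y)"
      "near_head t a x2 \<inter> insert e0 (del ?X) \<subseteq> insert e0 (outs E t y)" using A(3-6) by simp_all
  qed
  have fb: "f1 \<in> star E b1" "f2 \<in> star E b2" using mem by (simp_all add: star_def f1 f2)
  have finL: "finite (L e)" for e by (simp add: L_def)
  have cards: "3 \<le> card (L e1)" "3 \<le> card (L e2)" "2 \<le> card (L f1)" "2 \<le> card (L f2)"
    using Le[OF e1 mem(2) fb(1) tx(2) x1(1) A(3) o(2) near12(1) refl]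
      Le[OF e2 mem(3) fb(2) tx(3) x2(1) A(4) o(3) near12(2) refl]
      Lf[OF _ f1 mem(4) tx(4) x1(1) A(5) o(2) refl] Lf[OF _ f2 mem(5) tx(5) x2(1) A(6) o(3) refl]
    by simp_all
  obtain \<alpha>1 \<alpha>2 \<beta>1 \<beta>2 where col: "\<alpha>1 \<in> L e1" "\<alpha>2 \<in> L e2" "\<beta>1 \<in> L f1" "\<beta>2 \<in> L f2"
    "\<alpha>1 \<noteq> \<alpha>2" "{\<alpha>1, \<alpha>2} \<inter> {\<beta>1, \<beta>2} = {}"
    using four_lists[OF finL finL finL finL cards] by blast
  have avoid: "k \<notin> c1 ` (conflicts E t e \<inter> ?A)" "k < ?N" if "k \<in> L e" for k e
    using that by (auto simp: L_def)
  have no: "f1 \<notin> conflicts E t f2"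
  proof -
    have "f1 \<inter> nbrs E (t f2) = {}" "f2 \<inter> nbrs E (t f1) = {}"
      unfolding tx x1(1) x2(1) unfolding f1 f2 using x1(2) x2(2) b ne a(2) by simp_all
    then show ?thesis by (simp add: conflicts_def)
  qed
  define c2 where "c2 = c1(f1 := \<beta>1)"
  define c3 where "c3 = c2(f2 := \<beta>2)"
  define c4 where "c4 = c3(e1 := \<alpha>1)"
  define c5 where "c5 = c4(e2 := \<alpha>2)"
  have keep: "c2 f = c1 f" "c3 f = c1 f" "c4 f = c1 f" if "f \<in> ?A" for f
    using that A by (auto simp: c2_def c3_def c4_def)
  have vals: "c2 f1 = \<beta>1" "c3 f1 = \<beta>1" "c3 f2 = \<beta>2" "c4 f1 = \<beta>1" "c4 f2 = \<beta>2" "c4 e1 = \<alpha>1"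
    using neq by (auto simp: c2_def c3_def c4_def)
  have p2: "proper_on E t (insert f1 ?A) c2"
    unfolding c2_def by (rule proper_on_insert[OF c1(1) A(1) mem(4) A(3) avoid(1)[OF col(3)]])
  have p3: "proper_on E t (insert f2 (insert f1 ?A)) c3"
    unfolding c3_def
  proof (rule proper_on_insert[OF p2])
    show "\<beta>2 \<notin> c2 ` (conflicts E t f2 \<inter> insert f1 ?A)"
      using avoid(1)[OF col(4)] no keep(1) by (auto simp: image_iff)
  qed (use A mem neq in auto)
  have p4: "proper_on E t (insert e1 (insert f2 (insert f1 ?A))) c4"
    unfolding c4_def
  proof (rule proper_on_insert[OF p3])
    show "\<alpha>1 \<notin> c3 ` (conflicts E t e1 \<inter> insert f2 (insert f1 ?A))"
      using avoid(1)[OF col(1)] keep(2) vals col(6) by (auto simp: image_iff)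
  qed (use A mem neq in auto)
  have p5: "proper_on E t (insert e2 (insert e1 (insert f2 (insert f1 ?A)))) c5"
    unfolding c5_def
  proof (rule proper_on_insert[OF p4])
    show "\<alpha>2 \<notin> c4 ` (conflicts E t e2 \<inter> insert e1 (insert f2 (insert f1 ?A)))"
      using avoid(1)[OF col(2)] keep(3) vals col(5,6) by (auto simp: image_iff)
  qed (use A mem neq in auto)
  have "c5 ` E \<subseteq> {..<?N}"
  proof -
    have upd: "(c(e := k)) ` insert e A \<subseteq> S" if "c ` A \<subseteq> S" "k \<in> S" for c :: "'a set \<Rightarrow> nat" and e k A S
      using that by auto
    have "\<beta>1 \<in> {..<?N}" "\<beta>2 \<in> {..<?N}" "\<alpha>1 \<in> {..<?N}" "\<alpha>2 \<in> {..<?N}"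
      using avoid(2) col(1-4) by blast+
    then have "c5 ` insert e2 (insert e1 (insert f2 (insert f1 ?A))) \<subseteq> {..<?N}"
      unfolding c5_def c4_def c3_def c2_def by (intro upd c1(2))
    then show ?thesis by (simp only: E[symmetric])
  qed
  moreover have "proper_on E t E c5" using p5 E by simp
  ultimately show ?thesis using t(1) unfolding tail_colorable_def by blast
qed

text \<open>All tails are neighbors of \<open>a\<close>. The edges that lead away from \<open>a\<close> come first, since they would
  see all edges at \<open>a\<close> afterwards. Then each edge at \<open>a\<close> has at most six conflicts near \<open>a\<close>, as no
  edge has tail \<open>a\<close>, and \<open>K\<close> conflicts at the other neighbor of its tail.\<close>

lemma colorable_four:
  assumes a: "card (nbrs E a) = 4" and two: "\<And>x. x \<in> nbrs E a \<Longrightarrow> card (nbrs E x) = 2"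
    and indep: "\<And>x w. x \<in> nbrs E a \<Longrightarrow> w \<in> nbrs E x \<Longrightarrow> w \<notin> nbrs E a"
    and col: "tail_colorable (del (insert a (nbrs E a))) 2 (2 * K + 4)"
  shows "tail_colorable E 2 (2 * K + 4)"
proof -
  let ?M = "2 * K + 4" and ?N = "nbrs E a" and ?X = "insert a (nbrs E a)"
  obtain t0 c where c: "valid_tails (del ?X) t0 2" "c ` del ?X \<subseteq> {..<?M}"
    "proper_on (del ?X) t0 (del ?X) c"
    using col unfolding tail_colorable_def by blast
  have "\<exists>b. nbrs E x = {a, b} \<and> b \<noteq> a" if x: "x \<in> ?N" for x
    using edge_endpoints[OF two[OF x], of a] nbr_sym[of x a] x by metis
  then obtain b where b: "\<And>x. x \<in> ?N \<Longrightarrow> nbrs E x = {a, b x}" "\<And>x. x \<in> ?N \<Longrightarrow> b x \<noteq> a"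
    by metis
  have bN: "b x \<notin> ?N" if "x \<in> ?N" for x using indep[OF that] b(1)[OF that] by blast
  have aN: "a \<notin> ?N" using nbr_neq by blast
  define f g where f: "\<And>x. f x = {x, a}" and g: "\<And>x. g x = {x, b x}"
  \<comment> \<open>Each new edge contains exactly one neighbor of \<open>a\<close>.\<close>
  define t where "t e = (if e \<inter> ?X = {} then t0 e else the_elem (e \<inter> ?N))" for e
  have star_a: "star E a = f ` ?N" using star_eq[of a] by (simp add: f insert_commute)
  have star: "star E x = {f x, g x}" if "x \<in> ?N" for x
    using star_eq[of x] b(1)[OF that] by (simp add: f g)
  have mem: "f x \<in> E" "g x \<in> E" if "x \<in> ?N" for x
    using star[OF that] by (auto simp: star_def)
  have tx: "t (f x) = x" "t (g x) = x" if x: "x \<in> ?N" for x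
  proof -
    have "f x \<inter> ?N = {x}" "g x \<inter> ?N = {x}" using x aN bN[OF x] by (auto simp: f g)
    moreover have "f x \<inter> ?X \<noteq> {}" "g x \<inter> ?X \<noteq> {}" using x by (auto simp: f g)
    ultimately show "t (f x) = x" "t (g x) = x" by (simp_all add: t_def)
  qed
  have ag: "a \<notin> g x" "f y \<noteq> g x" if "x \<in> ?N" for x y
    using that aN b(2)[OF that] by (auto simp: f g)
  have notdel: "f x \<notin> del ?X" "g x \<notin> del ?X" if "x \<in> ?N" for x
    using that by (auto simp: del_def f g)
  have sub: "del ?X \<subseteq> E" by (auto simp: del_def)
  have stars: "(\<Union>x\<in>?X. star E x) = g ` ?N \<union> f ` ?N" using star_a star by auto
  have E: "E = del ?X \<union> g ` ?N \<union> f ` ?N" using del_Un_stars[of ?X] stars by blast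
  have new: "t e \<in> e \<inter> ?X" if "z \<in> ?X" "e \<in> star E z" for e z
  proof -
    have "e \<in> g ` ?N \<union> f ` ?N" using that stars by blast
    then obtain x where "x \<in> ?N" "e = f x \<or> e = g x" by blast
    then show ?thesis using tx[of x] by (auto simp: f g)
  qed
  have old: "t e = t0 e" if "e \<in> del ?X" for e using that by (simp add: t_def del_def)
  have os: "outs E t z \<subseteq> g ` ?N \<union> f ` ?N" if "z \<in> ?X" for z
    using outs_sub_stars[OF c(1) old that] stars by simp
  have outs_x: "outs E t x \<subseteq> {f x, g x}" if x: "x \<in> ?N" for x
  proof
    fix e assume e: "e \<in> outs E t x"
    then obtain z where z: "z \<in> ?N" "e = f z \<or> e = g z" using os[of x] x by blast
    then have "z = x" using tx[of z] e by (auto simp: outs_def)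
    then show "e \<in> {f x, g x}" using z by blast
  qed
  have outs_a: "outs E t a = {}"
  proof (rule ccontr)
    assume "outs E t a \<noteq> {}"
    then obtain e where e: "e \<in> outs E t a" by blast
    then obtain z where z: "z \<in> ?N" "e = f z \<or> e = g z" using os[of a] by blast
    then have "z = a" using tx[of z] e by (auto simp: outs_def)
    then show False using z aN by simp
  qed
  have o2: "card (outs E t z) \<le> 2" "card (excess E t z) \<le> 2" if "z \<in> ?X" for z
  proof -
    have "outs E t z \<subseteq> {f z, g z}" using that outs_x[of z] outs_a by blast
    then show "card (outs E t z) \<le> 2" "card (excess E t z) \<le> 2"
      by (rule card_sub_doubleton, rule card_sub_doubleton[OF order_trans[OF excess_sub]])
  qed
  have t: "valid_tails E t 2" "proper_on E t (del ?X) c"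
    by (rule extend_tails[OF c(1,3) old new o2]; assumption)+
  have exc: "card (excess E t v) \<le> 2" for v using t(1) by (simp add: valid_tails_def)
  have exc_a: "card (excess E t a) \<le> 0" using excess_sub[of t a] outs_a by simp
  have K: "4 \<le> K" using card_nbrs_le[of a] a by simp
  have star_a_del: "del ?X \<inter> star E a = {}" by (auto simp: del_def star_def)
  have "\<exists>c. proper_on E t (del ?X \<union> g ` S) c \<and> c ` (del ?X \<union> g ` S) \<subseteq> {..<?M}"
    if "finite S" "S \<subseteq> ?N" for S
    using that
  proof (induction S rule: finite_induct)
    case empty
    then show ?case using t(2) c(2) by auto
  next
    case (insert x S)
    let ?A = "del ?X \<union> g ` S"
    have x: "x \<in> ?N" and S: "S \<subseteq> ?N" using insert.prems by auto
    obtain c1 where c1: "proper_on E t ?A c1" "c1 ` ?A \<subseteq> {..<?M}"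
      using insert.IH[OF S] by blast
    have "g x \<notin> g ` S" using insert.hyps S tx(2) x by (metis imageE subsetD)
    then have A: "?A \<subseteq> E" "g x \<notin> ?A" using sub mem(2) S notdel(2)[OF x] by auto
    have fA: "f x \<notin> ?A" using notdel(1)[OF x] ag(2) S by blast
    have aA: "?A \<inter> star E a = {}" using star_a_del ag(1) S by (auto simp: star_def)
    have "card (conflicts E t (g x) \<inter> ?A) \<le> 2 * (K - 1) + 2 + card ({} :: 'a set set)"
    proof (rule card_conflicts_le[OF t(1) g mem(2)[OF x] tx(2)[OF x] card_nbrs_le exc])
      show "?A \<inter> (outs E t x - {g x}) \<subseteq> {}" using outs_x[OF x] fA by blast
      fix w assume w: "w \<in> nbrs E x" "w \<noteq> b x"
      then have "w = a" using b(1)[OF x] by simp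
      then show "?A \<inter> star E w \<subseteq> {}" using aA by simp
    qed simp
    then have "card (conflicts E t (g x) \<inter> ?A) < ?M" using K by simp
    then obtain c2 where "proper_on E t (insert (g x) ?A) c2" "c2 ` insert (g x) ?A \<subseteq> {..<?M}"
      using color_edge[OF c1 A(1) mem(2)[OF x] A(2)] by blast
    then show ?case by auto
  qed
  from this[of ?N] obtain c1 where c1: "proper_on E t (del ?X \<union> g ` ?N) c1"
      "c1 ` (del ?X \<union> g ` ?N) \<subseteq> {..<?M}"
    using finite_nbrs by blast
  have "\<exists>c. proper_on E t (del ?X \<union> g ` ?N \<union> f ` S) c \<and>
      c ` (del ?X \<union> g ` ?N \<union> f ` S) \<subseteq> {..<?M}"
    if "finite S" "S \<subseteq> ?N" for S
    using that
  proof (induction S rule: finite_induct)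
    case empty
    then show ?case using c1 by auto
  next
    case (insert x S)
    let ?A = "del ?X \<union> g ` ?N \<union> f ` S"
    have x: "x \<in> ?N" and S: "S \<subseteq> ?N" using insert.prems by auto
    obtain c2 where c2: "proper_on E t ?A c2" "c2 ` ?A \<subseteq> {..<?M}"
      using insert.IH[OF S] by blast
    have "f x \<notin> f ` S" using insert.hyps S tx(1) x by (metis imageE subsetD)
    then have A: "?A \<subseteq> E" "f x \<notin> ?A" using sub mem S notdel(1)[OF x] ag(2) by auto
    have gb: "g x \<in> star E (b x)" using mem(2)[OF x] by (simp add: star_def g)
    have "card (conflicts E t (f x) \<inter> ?A) \<le> 2 * (4 - 1) + 0 + card (star E (b x))"
    proof (rule card_conflicts_le[OF t(1) f mem(1)[OF x] tx(1)[OF x] _ exc_a finite_star])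
      have "outs E t x - {f x} \<subseteq> star E (b x)" using outs_x[OF x] gb by auto
      then show "?A \<inter> (outs E t x - {f x}) \<subseteq> star E (b x)" by (rule le_infI2)
      fix w assume w: "w \<in> nbrs E x" "w \<noteq> a"
      then have "w = b x" using b(1)[OF x] by simp
      then show "?A \<inter> star E w \<subseteq> star E (b x)" by simp
    qed (use a in simp)
    then have "card (conflicts E t (f x) \<inter> ?A) < ?M" using K card_star_le[of "b x"] by simp
    then obtain c3 where "proper_on E t (insert (f x) ?A) c3" "c3 ` insert (f x) ?A \<subseteq> {..<?M}"
      using color_edge[OF c2 A(1) mem(1)[OF x] A(2)] by blast
    then show ?case by auto
  qed
  from this[of ?N] obtain c2 where "proper_on E t E c2" "c2 ` E \<subseteq> {..<?M}"
    using finite_nbrs E by auto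
  then show ?thesis using t(1) unfolding tail_colorable_def by blast
qed

section \<open>Discharging\<close>

lemma nbrs_sub: "nbrs E v \<subseteq> V"
  using simple by (auto simp: nbrs_def simple_graph_def)

lemma finV: "finite V"
  using simple by (simp add: simple_graph_def)

lemma handshake: "(\<Sum>v\<in>V. card (nbrs E v)) = 2 * card E"
proof -
  have "(\<Sum>v\<in>V. card (nbrs E v)) = (\<Sum>v\<in>V. card {e \<in> E. v \<in> e})"
    by (simp add: card_star[symmetric] star_def)
  also have "\<dots> = 2 * card E"
  proof (rule sum_multicount[OF finV finE], rule ballI)
    fix e assume e: "e \<in> E"
    then have "{v \<in> V. v \<in> e} = e" using simple by (auto simp: simple_graph_def)
    then show "card {v \<in> V. v \<in> e} = 2" using card_edge[OF e] by simp
  qed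
  finally show ?thesis .
qed

text \<open>Let each vertex \<open>v\<close> start with the charge \<open>p * d v - q\<close>, where \<open>d v\<close> is its degree, and send
  \<open>r\<close> to each of its neighbors of degree two. A vertex of degree two has no such neighbors and ends with
  \<open>2 * p - q + 2 * r\<close>, which is \<open>0\<close>, and the other vertices stay nonnegative by assumption, so the total is nonnegative.\<close>

lemma discharge:
  fixes p q r :: nat
  assumes deg: "\<And>v. v \<in> V \<Longrightarrow> 2 \<le> card (nbrs E v)"
    and indep: "\<And>v w. card (nbrs E v) = 2 \<Longrightarrow> w \<in> nbrs E v \<Longrightarrow> card (nbrs E w) \<noteq> 2"
    and weight: "\<And>v. v \<in> V \<Longrightarrow> 3 \<le> card (nbrs E v) \<Longrightarrow>
      q + r * card {w \<in> nbrs E v. card (nbrs E w) = 2} \<le> p * card (nbrs E v)"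
    and q: "q = 2 * p + 2 * r"
  shows "q * card V \<le> 2 * p * card E"
proof -
  let ?d = "\<lambda>v. card (nbrs E v)"
  define T B where T: "T = {v \<in> V. ?d v = 2}" and B: "B = {v \<in> V. 3 \<le> ?d v}"
  have fin: "finite T" "finite B" using finV by (auto simp: T B)
  have split: "V = T \<union> B" "T \<inter> B = {}" using deg by (force simp: T B)+
  have "(\<Sum>v\<in>B. card {w \<in> T. w \<in> nbrs E v}) = 2 * card T"
  proof (rule sum_multicount[OF fin(2,1)], rule ballI)
    fix w assume w: "w \<in> T"
    have "{v \<in> B. w \<in> nbrs E v} = nbrs E w"
    proof
      show "nbrs E w \<subseteq> {v \<in> B. w \<in> nbrs E v}"
      proof
        fix v assume v: "v \<in> nbrs E w"
        have "?d v \<noteq> 2" using indep[of w v] w v by (simp add: T)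
        moreover have "v \<in> V" using nbrs_sub v by blast
        ultimately show "v \<in> {v \<in> B. w \<in> nbrs E v}" using deg[of v] v nbr_sym by (force simp: B)
      qed
    qed (use nbr_sym in auto)
    then show "card {v \<in> B. w \<in> nbrs E v} = 2" using w by (simp add: T)
  qed
  moreover have "{w \<in> T. w \<in> nbrs E v} = {w \<in> nbrs E v. ?d w = 2}" for v
    using nbrs_sub by (auto simp: T)
  ultimately have count: "(\<Sum>v\<in>B. card {w \<in> nbrs E v. ?d w = 2}) = 2 * card T" by simp
  have "(\<Sum>v\<in>B. q + r * card {w \<in> nbrs E v. ?d w = 2}) \<le> (\<Sum>v\<in>B. p * ?d v)"
    by (rule sum_mono) (use weight in \<open>simp add: B\<close>)
  then have "q * card B + r * (2 * card T) \<le> p * (\<Sum>v\<in>B. ?d v)"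
    by (simp add: sum.distrib sum_distrib_left[symmetric] count mult.commute[of q])
  moreover have "(\<Sum>v\<in>V. ?d v) = (\<Sum>v\<in>T. ?d v) + (\<Sum>v\<in>B. ?d v)"
    unfolding split(1) using fin split(2) by (rule sum.union_disjoint)
  moreover have "(\<Sum>v\<in>T. ?d v) = 2 * card T" by (simp add: T)
  ultimately have "q * card B + r * (2 * card T) + p * (2 * card T) \<le> p * (2 * card E)"
    using handshake by (simp add: add_mult_distrib2)
  moreover have "card V = card T + card B" using split fin by (simp add: card_Un_disjoint)
  ultimately show ?thesis using q by (simp add: algebra_simps)
qed

lemma bounded_graph_induced: "W \<subseteq> V \<Longrightarrow> bounded_graph W (induced_edges E W) K"
proof
  assume "W \<subseteq> V"
  then show "simple_graph W (induced_edges E W)"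
    using simple finV by (auto simp: simple_graph_def induced_edges_def intro: finite_subset)
  fix v
  have "vdegree (induced_edges E W) v \<le> vdegree E v"
    unfolding vdegree_def using finE by (intro card_mono) (auto simp: induced_edges_def)
  then show "vdegree (induced_edges E W) v \<le> K" using deg_le[of v] by linarith
qed

lemma other_nbr:
  assumes "card (nbrs E x) = 2" "a \<in> nbrs E x"
  obtains b where "nbrs E x = {a, b}" "b \<noteq> a"
  using edge_endpoints[OF assms] by blast

lemma degree_ge_two:
  assumes no: "\<not> tail_colorable E s N" and s: "1 \<le> s" "s \<le> 2" and N: "2 * K < N"
    and IH: "\<And>X. X \<subseteq> V \<Longrightarrow> X \<noteq> {} \<Longrightarrow> tail_colorable (del X) s N" and v: "v \<in> V"
  shows "2 \<le> card (nbrs E v)"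
proof (rule ccontr)
  assume "\<not> ?thesis"
  then consider "card (nbrs E v) = 0" | "card (nbrs E v) = 1" by linarith
  then show False
  proof cases
    case 1
    then show False using colorable_isolated[OF _ IH[of "{v}"]] finite_nbrs v no by simp
  next
    case 2
    then obtain w where "nbrs E v = {w}" by (rule card_1_singletonE)
    then show False using colorable_leaf[OF _ s N IH[of "{v}"]] v no by simp
  qed
qed

text \<open>In a graph without the three reducible configurations, vertices of degree three have at most one
  neighbor of degree two. Sending \<open>1\<close> to such neighbors with initial charge \<open>3 * d v - 8\<close> then
  contradicts the sparsity.\<close>

lemma sparse_8_3_induction_step:
  assumes sparse: "3 * card E < 4 * card V"
    and girth: "\<nexists>c. graph_cycle E c \<and> length c = 4"
    and IH: "\<And>X. X \<subseteq> V \<Longrightarrow> X \<noteq> {} \<Longrightarrow> tail_colorable (del X) 1 (2 * K + 2)"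
  shows "tail_colorable E 1 (2 * K + 2)"
proof (rule ccontr)
  assume no: "\<not> ?thesis"
  let ?d = "\<lambda>v. card (nbrs E v)"
  have deg: "2 \<le> ?d v" if "v \<in> V" for v
    by (rule degree_ge_two[OF no _ _ _ IH that]) simp_all
  have indep: "?d w \<noteq> 2" if vw: "?d v = 2" "w \<in> nbrs E v" for v w
  proof
    assume w: "?d w = 2"
    obtain a where a: "nbrs E v = {w, a}" "a \<noteq> w" using other_nbr[OF vw] by blast
    have "v \<in> nbrs E w" using nbr_sym vw by blast
    then obtain y where y: "nbrs E w = {v, y}" "y \<noteq> v" using other_nbr[OF w] by blast
    have "nbrs E v = {a, w}" using a by blast
    moreover have "{v, w} \<subseteq> V" using nbrs_sub vw \<open>v \<in> nbrs E w\<close> by blast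
    ultimately show False using colorable_two_two[OF _ _ y IH] a(2) no by blast
  qed
  have three: "card {w \<in> nbrs E a. ?d w = 2} \<le> 1" if a: "a \<in> V" "?d a = 3" for a
  proof (rule ccontr)
    let ?S = "{w \<in> nbrs E a. ?d w = 2}"
    assume "\<not> ?thesis"
    then obtain x1 x2 where x: "x1 \<in> ?S" "x2 \<in> ?S" "x1 \<noteq> x2"
      using finite_nbrs[of a] by (metis (no_types, lifting) card_le_Suc0_iff_eq finite_subset mem_Collect_eq One_nat_def subsetI)
    have "card (nbrs E a - {x1, x2}) = 1" using x a finite_nbrs[of a] by (simp add: card_Diff_subset)
    then obtain y where "nbrs E a - {x1, x2} = {y}" by (rule card_1_singletonE)
    then have y: "nbrs E a = {x1, x2, y}" "x1 \<noteq> y" "x2 \<noteq> y" using x by auto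
    have ax: "a \<in> nbrs E x1" "a \<in> nbrs E x2" using x nbr_sym by blast+
    obtain b1 where b1: "nbrs E x1 = {a, b1}" "b1 \<noteq> a" using other_nbr[of x1 a] x ax by blast
    obtain b2 where b2: "nbrs E x2 = {a, b2}" "b2 \<noteq> a" using other_nbr[of x2 a] x ax by blast
    have n: "b1 \<noteq> x2" "b2 \<noteq> x1" using indep[of x1 x2] indep[of x2 x1] x b1 b2 by auto
    have "b1 \<noteq> b2"
    proof
      assume eq: "b1 = b2"
      have "{x1, a} \<in> E" "{x1, b1} \<in> E" "{x2, b1} \<in> E" "{x2, a} \<in> E"
        using b1 b2 eq unfolding nbrs_def by blast+
      moreover have "x1 \<noteq> a" "x2 \<noteq> a" "b1 \<noteq> x1"
        using nbr_neq[of x1 a] nbr_neq[of x2 a] nbr_neq[of b1 x1] x b1 by auto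
      ultimately have "graph_cycle E [a, x1, b1, x2]"
        using n x(3) b1(2) by (intro four_cycle) (auto simp: insert_commute)
      then show False using girth by force
    qed
    moreover have "{a, x1, x2} \<subseteq> V" using nbrs_sub x a by blast
    ultimately show False using colorable_three[OF y(1) x(3) y(2,3) b1 b2 _ n IH] no by blast
  qed
  have "8 * card V \<le> 2 * 3 * card E"
  proof (rule discharge[where r = 1, OF deg indep])
    fix v assume v: "v \<in> V" "3 \<le> ?d v"
    have "card {w \<in> nbrs E v. ?d w = 2} \<le> ?d v" using finite_nbrs by (intro card_mono) auto
    then show "8 + 1 * card {w \<in> nbrs E v. ?d w = 2} \<le> 3 * ?d v"
      using three[OF v(1)] v(2) by (cases "?d v = 3") linarith+
  qed auto
  then show False using sparse by simp
qed

text \<open>The initial charge is \<open>5 * d v - 14\<close>, and vertices of degree two receive \<open>2\<close> from each neighbor.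
  These neighbors have degree at least four, and a vertex of degree four pays at most three times.\<close>

lemma sparse_14_5_induction_step:
  assumes sparse: "5 * card E < 7 * card V"
    and IH: "\<And>X. X \<subseteq> V \<Longrightarrow> X \<noteq> {} \<Longrightarrow> tail_colorable (del X) 2 (2 * K + 4)"
  shows "tail_colorable E 2 (2 * K + 4)"
proof (rule ccontr)
  assume no: "\<not> ?thesis"
  let ?d = "\<lambda>v. card (nbrs E v)"
  have deg: "2 \<le> ?d v" if "v \<in> V" for v
    by (rule degree_ge_two[OF no _ _ _ IH that]) simp_all
  have big: "4 \<le> ?d w" if vw: "?d v = 2" "w \<in> nbrs E v" for v w
  proof (rule ccontr)
    assume w: "\<not> 4 \<le> ?d w"
    obtain b where b: "nbrs E v = {w, b}" "b \<noteq> w" using other_nbr[OF vw] by blast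
    have "v \<in> V" using nbrs_sub nbr_sym vw by blast
    then show False using colorable_two_three[OF b(1) _ _ IH] b(2) w no by force
  qed
  have four: "card {w \<in> nbrs E a. ?d w = 2} \<le> 3" if a: "a \<in> V" "?d a = 4" for a
  proof (rule ccontr)
    let ?S = "{w \<in> nbrs E a. ?d w = 2}"
    assume "\<not> ?thesis"
    then have "card (nbrs E a) \<le> card ?S" using a by simp
    then have "?S = nbrs E a" using finite_nbrs[of a] by (intro card_seteq) auto
    then have two: "?d x = 2" if "x \<in> nbrs E a" for x using that by blast
    have "w \<notin> nbrs E a" if "x \<in> nbrs E a" "w \<in> nbrs E x" for x w
      using big[OF two[OF that(1)] that(2)] two[of w] by force
    moreover have "insert a (nbrs E a) \<subseteq> V" using nbrs_sub a by blast
    ultimately show False using colorable_four[OF a(2) two _ IH] no by blast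
  qed
  have "14 * card V \<le> 2 * 5 * card E"
  proof (rule discharge[where r = 2, OF deg])
    fix v w assume "?d v = 2" "w \<in> nbrs E v"
    then show "?d w \<noteq> 2" using big by force
  next
    fix v assume v: "v \<in> V" "3 \<le> ?d v"
    let ?n = "card {w \<in> nbrs E v. ?d w = 2}"
    have "?n \<le> ?d v" using finite_nbrs by (intro card_mono) auto
    moreover have "?n = 0" if "?d v = 3"
    proof -
      have "{w \<in> nbrs E v. ?d w = 2} = {}" using big nbr_sym that by force
      then show ?thesis by (simp only: card.empty)
    qed
    moreover have "?n \<le> 3" if "?d v = 4" using four v that by blast
    ultimately show "14 + 2 * ?n \<le> 5 * ?d v" using v(2) by linarith
  qed auto
  then show False using sparse by simp
qed

lemma tail_colorable_induced:
  assumes reduce: "\<And>W. W \<subseteq> V \<Longrightarrow> W \<noteq> {} \<Longrightarrow>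
      (\<And>X. X \<subseteq> W \<Longrightarrow> X \<noteq> {} \<Longrightarrow> tail_colorable (induced_edges E (W - X)) s N) \<Longrightarrow>
      tail_colorable (induced_edges E W) s N"
    and W: "W \<subseteq> V"
  shows "tail_colorable (induced_edges E W) s N"
  using W
proof (induction "card W" arbitrary: W rule: less_induct)
  case less
  have finW: "finite W" using less.prems finV finite_subset by blast
  show ?case
  proof (cases "W = {}")
    case True
    have "induced_edges E {} = {}" using card_edge by (force simp: induced_edges_def)
    then show ?thesis using True tail_colorable_empty by simp
  next
    case False
    show ?thesis
    proof (rule reduce[OF less.prems False])
      fix X assume X: "X \<subseteq> W" "X \<noteq> {}"
      then have "W - X \<subset> W" by blast
      then have "card (W - X) < card W" by (rule psubset_card_mono[OF finW])
      then show "tail_colorable (induced_edges E (W - X)) s N"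
        by (rule less.hyps) (use less.prems in blast)
    qed
  qed
qed

lemma del_induced:
  "bounded_graph W (induced_edges E W) K \<Longrightarrow>
    bounded_graph.del (induced_edges E W) X = induced_edges E (W - X)"
  by (subst bounded_graph.del_def) (auto simp: induced_edges_def)

lemma sparse_8_3_tail_colorable:
  assumes sparse: "\<And>W. W \<subseteq> V \<Longrightarrow> W \<noteq> {} \<Longrightarrow> 3 * card (induced_edges E W) < 4 * card W"
    and girth: "\<nexists>c. graph_cycle E c \<and> length c = 4"
  shows "tail_colorable E 1 (2 * K + 2)"
proof -
  have "tail_colorable (induced_edges E V) 1 (2 * K + 2)"
  proof (rule tail_colorable_induced[OF _ order_refl])
    fix W assume W: "W \<subseteq> V" "W \<noteq> {}"
      and IH: "\<And>X. X \<subseteq> W \<Longrightarrow> X \<noteq> {} \<Longrightarrow> tail_colorable (induced_edges E (W - X)) 1 (2 * K + 2)"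
    interpret G: bounded_graph W "induced_edges E W" K by (rule bounded_graph_induced[OF W(1)])
    have "\<nexists>c. graph_cycle (induced_edges E W) c \<and> length c = 4"
      using girth by (auto simp: graph_cycle_def induced_edges_def)
    then show "tail_colorable (induced_edges E W) 1 (2 * K + 2)"
      using G.sparse_8_3_induction_step[OF sparse[OF W]] IH del_induced[OF G.bounded_graph_axioms] by simp
  qed
  moreover have "induced_edges E V = E" using simple by (auto simp: simple_graph_def induced_edges_def)
  ultimately show ?thesis by simp
qed

lemma sparse_14_5_tail_colorable:
  assumes sparse: "\<And>W. W \<subseteq> V \<Longrightarrow> W \<noteq> {} \<Longrightarrow> 5 * card (induced_edges E W) < 7 * card W"
  shows "tail_colorable E 2 (2 * K + 4)"
proof -
  have "tail_colorable (induced_edges E V) 2 (2 * K + 4)"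
  proof (rule tail_colorable_induced[OF _ order_refl])
    fix W assume W: "W \<subseteq> V" "W \<noteq> {}"
      and IH: "\<And>X. X \<subseteq> W \<Longrightarrow> X \<noteq> {} \<Longrightarrow> tail_colorable (induced_edges E (W - X)) 2 (2 * K + 4)"
    interpret G: bounded_graph W "induced_edges E W" K by (rule bounded_graph_induced[OF W(1)])
    show "tail_colorable (induced_edges E W) 2 (2 * K + 4)"
      using G.sparse_14_5_induction_step[OF sparse[OF W]] IH del_induced[OF G.bounded_graph_axioms] by simp
  qed
  moreover have "induced_edges E V = E" using simple by (auto simp: simple_graph_def induced_edges_def)
  ultimately show ?thesis by simp
qed

end

theorem theorem1p4:
  fixes V :: "'a set" and E :: "'a set set"
  assumes "simple_graph V E" and "planar V E"
  shows "(girth E = 7 \<longrightarrow> semistrong_chromatic_index E \<le> 2 * max_degree V E + 4) \<and>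
         (8 \<le> girth E \<longrightarrow> semistrong_chromatic_index E \<le> 2 * max_degree V E + 2)"
proof -
  let ?K = "max_degree V E"
  have finV: "finite V" and sub: "\<And>e. e \<in> E \<Longrightarrow> e \<subseteq> V" and two: "\<forall>e\<in>E. card e = 2"
    using assms(1) by (auto simp: simple_graph_def)
  have deg: "vdegree E v \<le> ?K" for v
  proof (cases "v \<in> V")
    case True
    then show ?thesis using finV unfolding max_degree_def by (intro Max_ge) auto
  next
    case False
    then have "{e \<in> E. v \<in> e} = {}" using sub by blast
    then have "vdegree E v = 0" unfolding vdegree_def by (simp only: card.empty)
    then show ?thesis by simp
  qed
  interpret bounded_graph V E ?K by unfold_locales (rule assms(1), rule deg)
  have index: "semistrong_chromatic_index E \<le> N" if "tail_colorable E s N" for s N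
    unfolding semistrong_chromatic_index_def
    by (rule Least_le) (rule tail_colorable_imp_semistrong[OF two that])
  have cycles: "g \<le> length c" if "enat g \<le> girth E" "graph_cycle E c" for g c
  proof -
    have "girth E \<le> enat (length c)" unfolding girth_def using that(2) by (intro Inf_lower) auto
    then have "enat g \<le> enat (length c)" using that(1) by (rule order_trans[rotated])
    then show ?thesis by simp
  qed
  have sparse: "(g - 2) * card (induced_edges E W) < g * card W"
    if "enat g \<le> girth E" "2 \<le> g" "W \<subseteq> V" "W \<noteq> {}" for g W
    by (rule planar_girth_sparse[OF assms that(3,4,2)]) (rule cycles[OF that(1)])
  show ?thesis
  proof (intro conjI impI)
    assume "girth E = 7"
    then have "enat 7 \<le> girth E" by (simp add: numeral_eq_enat)
    then have "5 * card (induced_edges E W) < 7 * card W" if "W \<subseteq> V" "W \<noteq> {}" for W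
      using sparse[of 7 W] that by simp
    then show "semistrong_chromatic_index E \<le> 2 * ?K + 4"
      using index[OF sparse_14_5_tail_colorable] by blast
  next
    assume "8 \<le> girth E"
    then have g: "enat 8 \<le> girth E" by (simp add: numeral_eq_enat)
    have "3 * card (induced_edges E W) < 4 * card W" if "W \<subseteq> V" "W \<noteq> {}" for W
      using sparse[of 8 W] g that by simp
    moreover have "\<nexists>c. graph_cycle E c \<and> length c = 4" using cycles[OF g] by force
    ultimately show "semistrong_chromatic_index E \<le> 2 * ?K + 2"
      using index[OF sparse_8_3_tail_colorable] by blast
  qed
qed

end
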